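(* For $i=1,2$ let $\mathcal{X}_i$ be a locally compact Hausdorff space and let $\eta_i:\mathcal{X}_i\to\mathcal{X}_i$ be a proper continuous map. Then the dynamical systems $(\mathcal{X}_1,\eta_1)$ and $(\mathcal{X}_2,\eta_2)$ are conjugate if and only if the semicrossed products $C_0(\mathcal{X}_1)\times_{\eta_1}\mathbb{Z}^+$ and $C_0(\mathcal{X}_2)\times_{\eta_2}\mathbb{Z}^+$ are isomorphic as algebras.
   Context: Systems $(\mathcal{X}_1,\eta_1)$, $(\mathcal{X}_2,\eta_2)$ are conjugate if there is a homeomorphism $\gamma_s:\mathcal{X}_1\to\mathcal{X}_2$ with $\gamma_s\circ\eta_1=\eta_2\circ\gamma_s$. "Isomorphic as algebras" means there is a bijective complex algebra homomorphism; no continuity is assumed. Semicrossed product: let $\mathcal{X}$ be a locally compact Hausdorff space and $\eta$ a proper continuous self-map. For $x\in\mathcal{X}$ let $\mathcal{H}_x=\ell^2(\mathbb{N})$ be the space of square summable sequences $\xi=(\xi_n)_{n=0}^\infty$, and put $\pi_x(f)\xi=(f(x)\xi_0,(f\circ\eta)(x)\xi_1,(f\circ\eta^{(2)})(x)\xi_2,\dots)$ for $f\in C_0(\mathcal{X})$, where $\eta^{(n)}$ is the $n$-fold composition, and $U_x\xi=(0,\xi_0,\xi_1,\xi_2,\dots)$ (forward shift). Then $C_0(\mathcal{X})\times_\eta\mathbb{Z}^+$ is the norm closed operator algebra acting on $\bigoplus_{x\in\mathcal{X}}\mathcal{H}_x$ generated by the operators $\bigoplus_{x\in\mathcal{X}}\pi_x(f)$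 and $\bigoplus_{x\in\mathcal{X}}U_x\pi_x(g)$, $f,g\in C_0(\mathcal{X})$. (If $\mathcal{X}$ is compact, $C_0(\mathcal{X})=C(\mathcal{X})$.) *)

theory Defs
  imports "HOL-Analysis.Analysis"
begin

section \<open>The \<open>\<ell>\<^sup>2\<close>-direct sum of copies of a normed space\<close>

text \<open>
  \<open>('i, 'h) l2\<close> is the space of square summable families \<open>\<xi> :: 'i \<Rightarrow> 'h\<close>. It serves both for
  \<open>\<ell>\<^sup>2(\<nat>)\<close>, which is \<open>(nat, complex) l2\<close>, and for the Hilbert space direct sum of copies of
  \<open>\<ell>\<^sup>2(\<nat>)\<close> over the points of a space, which is \<open>('a, (nat, complex) l2) l2\<close>.
\<close>

definition square_summable :: "('i \<Rightarrow> 'h::real_normed_vector) \<Rightarrow> bool" where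
  "square_summable f \<longleftrightarrow> (\<lambda>i. (norm (f i))\<^sup>2) summable_on UNIV"

lemma L2_set_le_sqrt_infsum:
  assumes "square_summable f" "finite F"
  shows "L2_set (\<lambda>i. norm (f i)) F \<le> sqrt (\<Sum>\<^sub>\<infinity>i. (norm (f i))\<^sup>2)"
  unfolding L2_set_def
  using assms by (auto simp: square_summable_def intro!: finite_sum_le_infsum)

lemma square_summable_bound:
  assumes "\<And>F. finite F \<Longrightarrow> L2_set (\<lambda>i. norm (f i)) F \<le> c"
  shows "square_summable f" "sqrt (\<Sum>\<^sub>\<infinity>i. (norm (f i))\<^sup>2) \<le> c"
proof -
  have c: "0 \<le> c" using assms[of "{}"] by simp
  have *: "(\<Sum>i\<in>F. (norm (f i))\<^sup>2) \<le> c\<^sup>2" if "finite F" for F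
    using assms[OF that] c by (simp add: L2_set_def sqrt_le_D)
  show ss: "square_summable f"
    unfolding square_summable_def
    by (rule nonneg_bounded_partial_sums_imp_summable_on[where C = "c\<^sup>2"])
       (auto simp: * intro: eventually_finite_subsets_at_top_weakI)
  have "(\<Sum>\<^sub>\<infinity>i. (norm (f i))\<^sup>2) \<le> c\<^sup>2"
    using ss * by (intro infsum_le_finite_sums) (auto simp: square_summable_def)
  then show "sqrt (\<Sum>\<^sub>\<infinity>i. (norm (f i))\<^sup>2) \<le> c"
    using c by (simp add: real_le_lsqrt)
qed

lemma L2_set_norm_add_le:
  assumes "square_summable f" "square_summable g" "finite F"
  shows "L2_set (\<lambda>i. norm (f i + g i)) F
    \<le> sqrt (\<Sum>\<^sub>\<infinity>i. (norm (f i))\<^sup>2) + sqrt (\<Sum>\<^sub>\<infinity>i. (norm (g i))\<^sup>2)"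
proof -
  have "L2_set (\<lambda>i. norm (f i + g i)) F \<le> L2_set (\<lambda>i. norm (f i) + norm (g i)) F"
    by (intro L2_set_mono) (auto simp: norm_triangle_ineq)
  also have "\<dots> \<le> L2_set (\<lambda>i. norm (f i)) F + L2_set (\<lambda>i. norm (g i)) F"
    by (rule L2_set_triangle_ineq)
  also have "\<dots> \<le> sqrt (\<Sum>\<^sub>\<infinity>i. (norm (f i))\<^sup>2) + sqrt (\<Sum>\<^sub>\<infinity>i. (norm (g i))\<^sup>2)"
    using assms by (intro add_mono L2_set_le_sqrt_infsum)
  finally show ?thesis .
qed

lemma L2_set_norm_le_mult:
  assumes "square_summable f" "\<And>i. norm (g i) \<le> c * norm (f i)" "0 \<le> c" "finite F"
  shows "L2_set (\<lambda>i. norm (g i)) F \<le> c * sqrt (\<Sum>\<^sub>\<infinity>i. (norm (f i))\<^sup>2)"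
proof -
  have "L2_set (\<lambda>i. norm (g i)) F \<le> L2_set (\<lambda>i. c * norm (f i)) F"
    by (intro L2_set_mono) (auto simp: assms)
  also have "\<dots> = c * L2_set (\<lambda>i. norm (f i)) F"
    using assms by (simp add: L2_set_right_distrib)
  also have "\<dots> \<le> c * sqrt (\<Sum>\<^sub>\<infinity>i. (norm (f i))\<^sup>2)"
    using assms by (intro mult_left_mono L2_set_le_sqrt_infsum)
  finally show ?thesis .
qed

lemma square_summable_dominated:
  assumes "square_summable f" "\<And>i. norm (g i) \<le> c * norm (f i)" "0 \<le> c"
  shows "square_summable g"
  by (rule square_summable_bound(1)[OF L2_set_norm_le_mult[OF assms]])

typedef (overloaded) ('i, 'h::real_normed_vector) l2 = "{f :: 'i \<Rightarrow> 'h. square_summable f}"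
  morphisms l2_nth Abs_l2
  by (rule exI[of _ "\<lambda>_. 0"]) (simp add: square_summable_def)

setup_lifting type_definition_l2

instantiation l2 :: (type, real_normed_vector) real_normed_vector
begin

lift_definition zero_l2 :: "('a, 'b) l2" is "\<lambda>_. 0"
  by (simp add: square_summable_def)

lift_definition plus_l2 :: "('a, 'b) l2 \<Rightarrow> ('a, 'b) l2 \<Rightarrow> ('a, 'b) l2" is "\<lambda>f g i. f i + g i"
  by (rule square_summable_bound(1)[OF L2_set_norm_add_le])

lift_definition uminus_l2 :: "('a, 'b) l2 \<Rightarrow> ('a, 'b) l2" is "\<lambda>f i. - f i"
  by (simp add: square_summable_def)

lift_definition scaleR_l2 :: "real \<Rightarrow> ('a, 'b) l2 \<Rightarrow> ('a, 'b) l2" is "\<lambda>r f i. r *\<^sub>R f i"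
  by (erule square_summable_dominated[where c = "\<bar>r\<bar>" for r]) auto

definition minus_l2 :: "('a, 'b) l2 \<Rightarrow> ('a, 'b) l2 \<Rightarrow> ('a, 'b) l2" where
  "minus_l2 \<xi> \<zeta> = \<xi> + - \<zeta>"

lift_definition norm_l2 :: "('a, 'b) l2 \<Rightarrow> real" is "\<lambda>f. sqrt (\<Sum>\<^sub>\<infinity>i. (norm (f i))\<^sup>2)" .

definition dist_l2 :: "('a, 'b) l2 \<Rightarrow> ('a, 'b) l2 \<Rightarrow> real" where
  "dist_l2 \<xi> \<zeta> = norm (\<xi> - \<zeta>)"

definition sgn_l2 :: "('a, 'b) l2 \<Rightarrow> ('a, 'b) l2" where
  "sgn_l2 \<xi> = inverse (norm \<xi>) *\<^sub>R \<xi>"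

definition uniformity_l2 :: "(('a, 'b) l2 \<times> ('a, 'b) l2) filter" where
  "uniformity_l2 = (INF e\<in>{0 <..}. principal {(x, y). dist x y < e})"

definition open_l2 :: "('a, 'b) l2 set \<Rightarrow> bool" where
  "open_l2 S = (\<forall>x\<in>S. \<forall>\<^sub>F (x', y) in uniformity. x' = x \<longrightarrow> y \<in> S)"

instance
proof
  fix \<xi> \<zeta> \<upsilon> :: "('a, 'b) l2" and r s :: real
  show "\<xi> - \<zeta> = \<xi> + - \<zeta>" by (rule minus_l2_def)
  show "\<xi> + \<zeta> + \<upsilon> = \<xi> + (\<zeta> + \<upsilon>)" by transfer (simp add: add.assoc)
  show "\<xi> + \<zeta> = \<zeta> + \<xi>" by transfer (simp add: add.commute)
  show "0 + \<xi> = \<xi>" by transfer simp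
  show "- \<xi> + \<xi> = 0" by transfer simp
  show "r *\<^sub>R (\<xi> + \<zeta>) = r *\<^sub>R \<xi> + r *\<^sub>R \<zeta>" by transfer (simp add: scaleR_add_right)
  show "(r + s) *\<^sub>R \<xi> = r *\<^sub>R \<xi> + s *\<^sub>R \<xi>" by transfer (simp add: scaleR_add_left)
  show "r *\<^sub>R s *\<^sub>R \<xi> = (r * s) *\<^sub>R \<xi>" by transfer simp
  show "1 *\<^sub>R \<xi> = \<xi>" by transfer simp
  show "dist \<xi> \<zeta> = norm (\<xi> - \<zeta>)" by (rule dist_l2_def)
  show "sgn \<xi> = inverse (norm \<xi>) *\<^sub>R \<xi>" by (rule sgn_l2_def)
  show "(uniformity :: (('a, 'b) l2 \<times> ('a, 'b) l2) filter)
      = (INF e\<in>{0 <..}. principal {(x, y). dist x y < e})" by (rule uniformity_l2_def)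
  show "open U = (\<forall>x\<in>U. \<forall>\<^sub>F (x', y) in uniformity. x' = x \<longrightarrow> y \<in> U)"
    for U :: "('a, 'b) l2 set" by (rule open_l2_def)
  show "norm \<xi> = 0 \<longleftrightarrow> \<xi> = 0"
  proof transfer
    fix f :: "'a \<Rightarrow> 'b" assume f: "square_summable f"
    show "sqrt (\<Sum>\<^sub>\<infinity>i. (norm (f i))\<^sup>2) = 0 \<longleftrightarrow> f = (\<lambda>_. 0)"
    proof
      assume 0: "sqrt (\<Sum>\<^sub>\<infinity>i. (norm (f i))\<^sup>2) = 0"
      have "norm (f i) \<le> 0" for i
        using L2_set_le_sqrt_infsum[OF f, of "{i}"] 0 by (simp add: L2_set_def)
      then show "f = (\<lambda>_. 0)" by auto
    qed simp
  qed
  show "norm (\<xi> + \<zeta>) \<le> norm \<xi> + norm \<zeta>"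
    by transfer (rule square_summable_bound(2)[OF L2_set_norm_add_le])
  show "norm (r *\<^sub>R \<xi>) = \<bar>r\<bar> * norm \<xi>"
    by transfer (simp add: power_mult_distrib infsum_cmult_right' real_sqrt_mult)
qed

end

lemma l2_eqI: "(\<And>i. l2_nth \<xi> i = l2_nth \<zeta> i) \<Longrightarrow> \<xi> = \<zeta>"
  by (metis ext l2_nth_inject)

section \<open>Operators\<close>

text \<open>
  \<open>\<Oplus>i\<in>I. T i\<close> for a uniformly bounded family \<open>T\<close>. The direct sum of copies of \<open>'h\<close> over \<open>I\<close> is
  identified with the families in \<open>('i, 'h) l2\<close> that vanish off \<open>I\<close>, and an operator on it with its
  extension by zero on the complementary summand; this extension is isometric and respects all
  the algebra operations. If \<open>T\<close> is not uniformly bounded the value is the dummy 0.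
\<close>

definition direct_sum_op ::
  "'i set \<Rightarrow> ('i \<Rightarrow> 'h \<Rightarrow>\<^sub>L 'h::real_normed_vector) \<Rightarrow> ('i, 'h) l2 \<Rightarrow>\<^sub>L ('i, 'h) l2" where
  "direct_sum_op I T = Blinfun
    (\<lambda>\<xi>. if bounded (T ` I) then Abs_l2 (\<lambda>i. if i \<in> I then T i (l2_nth \<xi> i) else 0) else 0)"

lemma direct_sum_op_apply:
  fixes I :: "'i set" and T :: "'i \<Rightarrow> 'h \<Rightarrow>\<^sub>L 'h::real_normed_vector"
  shows "direct_sum_op I T \<xi>
    = (if bounded (T ` I) then Abs_l2 (\<lambda>i. if i \<in> I then T i (l2_nth \<xi> i) else 0) else 0)"
proof -
  have "bounded_linear
    (\<lambda>\<xi>. if bounded (T ` I) then Abs_l2 (\<lambda>i. if i \<in> I then T i (l2_nth \<xi> i) else 0) else 0)"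
  proof (cases "bounded (T ` I)")
    case True
    then obtain c where c: "0 < c" "\<And>i. i \<in> I \<Longrightarrow> norm (T i) \<le> c"
      by (auto simp: bounded_pos)
    let ?g = "\<lambda>(\<xi> :: ('i, 'h) l2) i. if i \<in> I then T i (l2_nth \<xi> i) else 0"
    have le: "norm (?g \<xi> i) \<le> c * norm (l2_nth \<xi> i)" for \<xi> i
      using c by (auto intro!: order_trans[OF norm_blinfun] mult_right_mono)
    have ss: "square_summable (?g \<xi>)" for \<xi>
      using l2_nth[of \<xi>] c le by (auto intro!: square_summable_dominated[of "l2_nth \<xi>" _ c])
    have nth: "l2_nth (Abs_l2 (?g \<xi>)) = ?g \<xi>" for \<xi>
      using ss by (simp add: Abs_l2_inverse)
    have "bounded_linear (\<lambda>\<xi>. Abs_l2 (?g \<xi>))"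
    proof (rule bounded_linear_intro[where K = c])
      show "Abs_l2 (?g (\<xi> + \<zeta>)) = Abs_l2 (?g \<xi>) + Abs_l2 (?g \<zeta>)" for \<xi> \<zeta>
        by (rule l2_eqI) (simp add: nth plus_l2.rep_eq blinfun.add_right)
      show "Abs_l2 (?g (r *\<^sub>R \<xi>)) = r *\<^sub>R Abs_l2 (?g \<xi>)" for r \<xi>
        by (rule l2_eqI) (simp add: nth scaleR_l2.rep_eq blinfun.scaleR_right)
      show "norm (Abs_l2 (?g \<xi>)) \<le> norm \<xi> * c" for \<xi>
        unfolding norm_l2.rep_eq nth mult.commute[of _ c]
        using l2_nth[of \<xi>] c le
        by (auto intro!: square_summable_bound(2) L2_set_norm_le_mult[of "l2_nth \<xi>"])
    qed
    with True show ?thesis by simp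
  qed simp
  then show ?thesis unfolding direct_sum_op_def by (simp only: bounded_linear_Blinfun_apply)
qed

lemma l2_nth_direct_sum_op:
  assumes "bounded (T ` I)"
  shows "l2_nth (direct_sum_op I T \<xi>) i = (if i \<in> I then T i (l2_nth \<xi> i) else 0)"
proof -
  obtain c where c: "0 < c" "\<And>i. i \<in> I \<Longrightarrow> norm (T i) \<le> c"
    using assms by (auto simp: bounded_pos)
  have "square_summable (\<lambda>i. if i \<in> I then T i (l2_nth \<xi> i) else 0)"
    using l2_nth[of \<xi>] c
    by (auto intro!: square_summable_dominated[of "l2_nth \<xi>" _ c]
        order_trans[OF norm_blinfun] mult_right_mono)
  then show ?thesis
    using assms by (simp add: direct_sum_op_apply Abs_l2_inverse)
qed

lemma norm_direct_sum_op_le: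
  assumes "\<And>i. i \<in> I \<Longrightarrow> norm (T i) \<le> c" "0 \<le> c"
  shows "norm (direct_sum_op I T) \<le> c"
proof (rule norm_blinfun_bound[OF assms(2)])
  fix \<xi>
  have b: "bounded (T ` I)" using assms by (auto simp: bounded_iff)
  show "norm (direct_sum_op I T \<xi>) \<le> c * norm \<xi>"
    unfolding norm_l2.rep_eq
    using l2_nth[of \<xi>] assms
    by (auto intro!: square_summable_bound(2) L2_set_norm_le_mult[of "l2_nth \<xi>"]
        order_trans[OF norm_blinfun] mult_right_mono simp: l2_nth_direct_sum_op[OF b])
qed

abbreviation diag_op :: "(nat \<Rightarrow> complex) \<Rightarrow> (nat, complex) l2 \<Rightarrow>\<^sub>L (nat, complex) l2" where
  "diag_op a \<equiv> direct_sum_op UNIV (\<lambda>n. blinfun_mult_right (a n))"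

definition shift :: "(nat, complex) l2 \<Rightarrow>\<^sub>L (nat, complex) l2" where
  "shift = Blinfun (\<lambda>\<xi>. Abs_l2 (case_nat 0 (l2_nth \<xi>)))"

lemma l2_nth_shift: "l2_nth (shift \<xi>) n = (case n of 0 \<Rightarrow> 0 | Suc m \<Rightarrow> l2_nth \<xi> m)"
proof -
  let ?g = "\<lambda>\<xi> :: (nat, complex) l2. case_nat 0 (l2_nth \<xi>)"
  have le: "L2_set (\<lambda>n. norm (?g \<xi> n)) F \<le> norm \<xi>" if "finite F" for F \<xi>
  proof -
    let ?G = "(\<lambda>n. n - 1) ` (F - {0})"
    have "(\<Sum>n\<in>F. (norm (?g \<xi> n))\<^sup>2) = (\<Sum>n\<in>F - {0}. (norm (?g \<xi> n))\<^sup>2)"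
      using that by (intro sum.mono_neutral_right) auto
    also have "\<dots> = (\<Sum>n\<in>?G. (norm (l2_nth \<xi> n))\<^sup>2)"
      by (subst sum.reindex)
         (auto simp: inj_on_def intro!: sum.cong split: nat.split_asm)
    finally have "L2_set (\<lambda>n. norm (?g \<xi> n)) F = L2_set (\<lambda>n. norm (l2_nth \<xi> n)) ?G"
      by (simp add: L2_set_def)
    then show ?thesis
      using L2_set_le_sqrt_infsum[of "l2_nth \<xi>" ?G] l2_nth[of \<xi>] that
      by (simp add: norm_l2.rep_eq)
  qed
  have nth: "l2_nth (Abs_l2 (?g \<xi>)) = ?g \<xi>" for \<xi>
    using square_summable_bound(1)[OF le] by (simp add: Abs_l2_inverse)
  have "bounded_linear (\<lambda>\<xi>. Abs_l2 (?g \<xi>))"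
  proof (rule bounded_linear_intro[where K = 1])
    show "Abs_l2 (?g (\<xi> + \<zeta>)) = Abs_l2 (?g \<xi>) + Abs_l2 (?g \<zeta>)" for \<xi> \<zeta>
      by (rule l2_eqI) (unfold nth, simp add: plus_l2.rep_eq nth split: nat.split)
    show "Abs_l2 (?g (r *\<^sub>R \<xi>)) = r *\<^sub>R Abs_l2 (?g \<xi>)" for r \<xi>
      by (rule l2_eqI) (unfold nth, simp add: scaleR_l2.rep_eq nth split: nat.split)
    show "norm (Abs_l2 (?g \<xi>)) \<le> norm \<xi> * 1" for \<xi>
      using square_summable_bound(2)[OF le[of _ \<xi>]] by (simp add: norm_l2.rep_eq nth)
  qed
  then show ?thesis
    unfolding shift_def by (simp add: bounded_linear_Blinfun_apply nth)
qed

text \<open>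
  The library has no complex normed spaces, so \<open>blinfun\<close> consists of the bounded real-linear
  operators. Complex scalars are supplied by composing with the operator of multiplication by \<open>c\<close>.
\<close>

type_synonym 'a op = "('a, (nat, complex) l2) l2 \<Rightarrow>\<^sub>L ('a, (nat, complex) l2) l2"

definition scalar_op :: "complex \<Rightarrow> 'a op" where
  "scalar_op c = direct_sum_op UNIV (\<lambda>_. diag_op (\<lambda>_. c))"

definition scaleC_op :: "complex \<Rightarrow> 'a op \<Rightarrow> 'a op" where
  "scaleC_op c T = scalar_op c o\<^sub>L T"

lemma l2_nth_scaleC_op: "l2_nth (l2_nth (scaleC_op c T \<xi>) x) n = c * l2_nth (l2_nth (T \<xi>) x) n"
proof -
  have "bounded (range (\<lambda>_::'b. d))" for d :: "'c::real_normed_vector"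
    by (rule bounded_subset[of "{d}"]) auto
  then show ?thesis
    by (simp add: scaleC_op_def scalar_op_def l2_nth_direct_sum_op image_constant_conv)
qed

section \<open>Semicrossed products\<close>

text \<open>Functions on \<open>X\<close> are total functions whose values off \<open>topspace X\<close> are never used.\<close>

definition C0 :: "'a topology \<Rightarrow> ('a \<Rightarrow> complex) set" where
  "C0 X = {f. continuous_map X euclidean f \<and>
    (\<forall>\<epsilon>>0. \<exists>K. compactin X K \<and> (\<forall>x\<in>topspace X - K. norm (f x) < \<epsilon>))}"

definition pi_rep :: "('a \<Rightarrow> 'a) \<Rightarrow> ('a \<Rightarrow> complex) \<Rightarrow> 'a \<Rightarrow> (nat, complex) l2 \<Rightarrow>\<^sub>L (nat, complex) l2"
  where "pi_rep \<eta> f x = diag_op (\<lambda>n. f ((\<eta> ^^ n) x))"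

definition semicrossed_generators :: "'a topology \<Rightarrow> ('a \<Rightarrow> 'a) \<Rightarrow> 'a op set" where
  "semicrossed_generators X \<eta> =
     {direct_sum_op (topspace X) (\<lambda>x. pi_rep \<eta> f x) | f. f \<in> C0 X} \<union>
     {direct_sum_op (topspace X) (\<lambda>x. shift o\<^sub>L pi_rep \<eta> g x) | g. g \<in> C0 X}"

definition operator_subalgebra :: "'a op set \<Rightarrow> bool" where
  "operator_subalgebra A \<longleftrightarrow> 0 \<in> A \<and>
     (\<forall>S\<in>A. \<forall>T\<in>A. S + T \<in> A) \<and> (\<forall>c. \<forall>T\<in>A. scaleC_op c T \<in> A) \<and> (\<forall>S\<in>A. \<forall>T\<in>A. S o\<^sub>L T \<in> A)"

definition semicrossed_product :: "'a topology \<Rightarrow> ('a \<Rightarrow> 'a) \<Rightarrow> 'a op set" where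
  "semicrossed_product X \<eta> = (\<lambda>A. operator_subalgebra A \<and> closed A) hull semicrossed_generators X \<eta>"

definition algebra_isomorphic :: "'a op set \<Rightarrow> 'b op set \<Rightarrow> bool" where
  "algebra_isomorphic A B \<longleftrightarrow> (\<exists>\<Phi>. bij_betw \<Phi> A B \<and>
     (\<forall>S\<in>A. \<forall>T\<in>A. \<Phi> (S + T) = \<Phi> S + \<Phi> T) \<and>
     (\<forall>c. \<forall>T\<in>A. \<Phi> (scaleC_op c T) = scaleC_op c (\<Phi> T)) \<and>
     (\<forall>S\<in>A. \<forall>T\<in>A. \<Phi> (S o\<^sub>L T) = \<Phi> S o\<^sub>L \<Phi> T))"

definition conjugate_systems :: "'a topology \<Rightarrow> ('a \<Rightarrow> 'a) \<Rightarrow> 'b topology \<Rightarrow> ('b \<Rightarrow> 'b) \<Rightarrow> bool" where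
  "conjugate_systems X1 \<eta>1 X2 \<eta>2 \<longleftrightarrow>
     (\<exists>\<gamma>. homeomorphic_map X1 X2 \<gamma> \<and> (\<forall>x\<in>topspace X1. \<gamma> (\<eta>1 x) = \<eta>2 (\<gamma> x)))"

text \<open>The generators act as expected (none of the dummy values above occurs).\<close>

lemma bounded_C0:
  assumes "f \<in> C0 X"
  obtains c where "0 \<le> c" "\<And>x. x \<in> topspace X \<Longrightarrow> norm (f x) \<le> c"
proof -
  obtain K where K: "compactin X K" "\<And>x. x \<in> topspace X - K \<Longrightarrow> norm (f x) < 1"
    using assms unfolding C0_def by (auto dest!: spec[of _ "1::real"])
  have "compactin euclidean (f ` K)"
    using K assms image_compactin unfolding C0_def by blast
  then have "bounded (f ` K)"
    by (simp add: compactin_euclidean_iff compact_imp_bounded)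
  then obtain d where "\<And>x. x \<in> K \<Longrightarrow> norm (f x) \<le> d"
    by (auto simp: bounded_iff)
  then show ?thesis
    using K by (intro that[of "max 1 d"]) (auto simp: le_max_iff_disj intro: less_imp_le)
qed

lemma norm_blinfun_mult_right_le: "norm (blinfun_mult_right (a::complex)) \<le> norm a"
  by (rule norm_blinfun_bound) (auto simp: norm_mult)

context
  fixes X :: "'a topology" and \<eta> :: "'a \<Rightarrow> 'a" and f :: "'a \<Rightarrow> complex"
  assumes \<eta>: "continuous_map X X \<eta>" and f: "f \<in> C0 X"
begin

private lemma iter: "x \<in> topspace X \<Longrightarrow> (\<eta> ^^ n) x \<in> topspace X"
  using \<eta> by (induction n) (auto simp: continuous_map_def Pi_iff)

lemma l2_nth_pi_rep:
  assumes "x \<in> topspace X"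
  shows "l2_nth (pi_rep \<eta> f x \<xi>) n = f ((\<eta> ^^ n) x) * l2_nth \<xi> n"
proof -
  obtain c where c: "0 \<le> c" "\<And>x. x \<in> topspace X \<Longrightarrow> norm (f x) \<le> c"
    using bounded_C0[OF f] by blast
  then have "bounded (range (\<lambda>n. blinfun_mult_right (f ((\<eta> ^^ n) x))))"
    using iter[OF assms] unfolding bounded_iff
    by (auto intro!: exI[of _ c] order_trans[OF norm_blinfun_mult_right_le])
  then show ?thesis
    by (simp add: pi_rep_def l2_nth_direct_sum_op)
qed

lemma bounded_pi_rep: "bounded (pi_rep \<eta> f ` topspace X)"
proof -
  obtain c where c: "0 \<le> c" "\<And>x. x \<in> topspace X \<Longrightarrow> norm (f x) \<le> c"
    using bounded_C0[OF f] by blast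
  then show ?thesis
    using iter unfolding bounded_iff pi_rep_def
    by (auto intro!: exI[of _ c] norm_direct_sum_op_le order_trans[OF norm_blinfun_mult_right_le])
qed

lemma bounded_shift_pi_rep: "bounded ((\<lambda>x. shift o\<^sub>L pi_rep \<eta> f x) ` topspace X)"
proof -
  obtain c where c: "\<And>x. x \<in> topspace X \<Longrightarrow> norm (pi_rep \<eta> f x) \<le> c"
    using bounded_pi_rep by (auto simp: bounded_iff)
  then show ?thesis
    unfolding bounded_iff
    by (auto intro!: exI[of _ "norm shift * c"] order_trans[OF norm_blinfun_compose] mult_left_mono)
qed

lemma generator_apply:
  "l2_nth (l2_nth (direct_sum_op (topspace X) (pi_rep \<eta> f) \<xi>) x) n
     = (if x \<in> topspace X then f ((\<eta> ^^ n) x) * l2_nth (l2_nth \<xi> x) n else 0)"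
  by (simp add: l2_nth_direct_sum_op bounded_pi_rep l2_nth_pi_rep zero_l2.rep_eq)

lemma shift_generator_apply:
  "l2_nth (l2_nth (direct_sum_op (topspace X) (\<lambda>x. shift o\<^sub>L pi_rep \<eta> f x) \<xi>) x) n
     = (if x \<in> topspace X then (case n of 0 \<Rightarrow> 0 | Suc m \<Rightarrow> f ((\<eta> ^^ m) x) * l2_nth (l2_nth \<xi> x) m)
        else 0)"
  by (simp add: l2_nth_direct_sum_op bounded_shift_pi_rep l2_nth_pi_rep l2_nth_shift
      zero_l2.rep_eq split: nat.split)

end

end

theory Submission
  imports Defs "HOL-Complex_Analysis.Complex_Analysis"
begin

text \<open>
  An element \<open>a\<close> of the semicrossed product is a formal series \<open>\<Sum> U\<^sup>n f\<^sub>n\<close> with \<open>f\<^sub>n\<close> in \<open>C\<^sub>0(X)\<close>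
  and \<open>f U = U (f \<circ> \<eta>)\<close>. A character restricts to evaluation at a point \<open>x\<close> on \<open>C\<^sub>0(X)\<close>. Over a point
  that is not fixed it must be \<open>a \<mapsto> f\<^sub>0(x)\<close>; over a fixed point the characters
  \<open>\<theta>(x,z) : a \<mapsto> \<Sum> f\<^sub>n(x) z\<^sup>n\<close> form an analytic disc. An algebra isomorphism pulls characters back to
  characters, and it maps discs into discs, because a holomorphic function with real values is
  constant. This gives a bijection \<open>\<gamma>\<close> of the spaces; it is a homeomorphism because \<open>f \<circ> \<gamma>\<close> is the zeroth
  coefficient of the image of \<open>f\<close>, hence in \<open>C\<^sub>0\<close>.

  The dynamics is read off from point derivations \<open>D(ab) = D(a) \<phi>(b) + \<psi>(a) D(b)\<close> (the representations
  by triangular matrices of size two): for \<open>\<phi> = \<theta>(x,0)\<close> and \<open>\<psi> = \<theta>(y,0)\<close> with \<open>x \<noteq> y\<close>, every such \<open>D\<close> is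
  a multiple of \<open>\<phi> - \<psi>\<close> unless \<open>y = \<eta> x\<close>, whereas \<open>a \<mapsto> \<Sum> f\<^sub>n\<^sub>+\<^sub>1(x) z\<^sup>n\<close> is not, for
  \<open>\<phi> = \<theta>(x,0)\<close> and \<open>\<psi> = \<theta>(\<eta> x,z)\<close>. Conversely, a conjugacy transports the operators spatially.
\<close>

section \<open>Square summable families\<close>

lemma norm_l2_nth_le: "norm (l2_nth \<xi> i) \<le> norm \<xi>"
  using L2_set_le_sqrt_infsum[OF l2_nth[of \<xi>, simplified], of "{i}"] by (simp add: norm_l2.rep_eq)

lemma l2_nth_diff: "l2_nth (\<xi> - \<zeta>) i = l2_nth \<xi> i - l2_nth \<zeta> i"
  unfolding minus_l2_def plus_l2.rep_eq uminus_l2.rep_eq by simp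

lemma L2_set_le_norm_l2: "finite F \<Longrightarrow> L2_set (\<lambda>i. norm (l2_nth \<xi> i)) F \<le> norm \<xi>"
  using L2_set_le_sqrt_infsum[of "l2_nth \<xi>"] l2_nth[of \<xi>] by (simp add: norm_l2.rep_eq)

lemma bounded_linear_l2_nth: "bounded_linear (\<lambda>\<xi>. l2_nth \<xi> i)"
  by (rule bounded_linear_intro[where K = 1])
     (auto simp: plus_l2.rep_eq scaleR_l2.rep_eq norm_l2_nth_le)

text \<open>Completeness passes on to the operators, and the contraction argument in
  \<open>character_norm_le\<close> rests on it. Coordinates converge separately; the Cauchy bound on
  \<open>L2_set\<close> survives the limit uniformly over all finite index sets.\<close>

instance l2 :: (type, banach) banach
proof
  fix X :: "nat \<Rightarrow> ('a, 'b) l2"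
  assume X: "Cauchy X"
  have "Cauchy (\<lambda>n. l2_nth (X n) i)" for i
    by (rule bounded_linear.Cauchy[OF bounded_linear_l2_nth X])
  then have "\<forall>i. \<exists>l. (\<lambda>n. l2_nth (X n) i) \<longlonglongrightarrow> l"
    by (simp add: Cauchy_convergent_iff convergent_def)
  then obtain f where f: "\<And>i. (\<lambda>n. l2_nth (X n) i) \<longlonglongrightarrow> f i" by metis
  have bound: "\<exists>N. \<forall>m\<ge>N. \<forall>F. finite F \<longrightarrow> L2_set (\<lambda>i. norm (l2_nth (X m) i - f i)) F \<le> e"
    if "e > 0" for e
  proof -
    obtain N where N: "\<And>m n. m \<ge> N \<Longrightarrow> n \<ge> N \<Longrightarrow> norm (X m - X n) < e"
      using X \<open>e > 0\<close> unfolding Cauchy_iff by blast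
    have "L2_set (\<lambda>i. norm (l2_nth (X m) i - f i)) F \<le> e" if "m \<ge> N" "finite F" for m F
    proof (rule LIMSEQ_le_const2)
      show "(\<lambda>n. L2_set (\<lambda>i. norm (l2_nth (X m - X n) i)) F)
          \<longlonglongrightarrow> L2_set (\<lambda>i. norm (l2_nth (X m) i - f i)) F"
        unfolding L2_set_def l2_nth_diff by (intro tendsto_intros f)
      show "\<exists>M. \<forall>n\<ge>M. L2_set (\<lambda>i. norm (l2_nth (X m - X n) i)) F \<le> e"
        using N[OF \<open>m \<ge> N\<close>] L2_set_le_norm_l2[OF \<open>finite F\<close>, of "X m - X n" for n]
        by (intro exI[of _ N] allI impI) (rule order_trans, assumption, rule less_imp_le, blast)
    qed
    then show ?thesis by blast
  qed
  \<comment> \<open>The pointwise limit \<open>f\<close> is not yet known to be square summable, but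
    its difference from the late term \<open>X N\<close> is. Hence the limit vector is built as
    \<open>X N - h\<close>.\<close>
  obtain N where N: "\<And>F. finite F \<Longrightarrow> L2_set (\<lambda>i. norm (l2_nth (X N) i - f i)) F \<le> 1"
    using bound[of 1] by auto
  define h where "h = Abs_l2 (\<lambda>i. l2_nth (X N) i - f i)"
  have h: "l2_nth h = (\<lambda>i. l2_nth (X N) i - f i)"
    using square_summable_bound(1)[OF N] by (simp add: h_def Abs_l2_inverse)
  have "X \<longlonglongrightarrow> X N - h"
  proof (rule LIMSEQ_I)
    fix r :: real assume "r > 0"
    then obtain M where M: "\<And>m F. m \<ge> M \<Longrightarrow> finite F \<Longrightarrow>
        L2_set (\<lambda>i. norm (l2_nth (X m) i - f i)) F \<le> r / 2"
      using bound[of "r/2"] by auto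
    have "norm (X m - (X N - h)) < r" if "m \<ge> M" for m
    proof -
      have "norm (X m - (X N - h)) \<le> r / 2"
        unfolding norm_l2.rep_eq
        by (rule square_summable_bound(2)) (use M[OF that] in \<open>simp add: l2_nth_diff h\<close>)
      then show ?thesis using \<open>r > 0\<close> by simp
    qed
    then show "\<exists>M. \<forall>m\<ge>M. norm (X m - (X N - h)) < r" by blast
  qed
  then show "convergent X" by (auto simp: convergent_def)
qed

section \<open>Coordinate vectors, norm estimates and the backward shift\<close>

definition l2_single :: "'i \<Rightarrow> 'h::real_normed_vector \<Rightarrow> ('i, 'h) l2" where
  "l2_single i h = Abs_l2 (\<lambda>j. if j = i then h else 0)"

lemma L2_set_single_le: "finite F \<Longrightarrow> L2_set (\<lambda>j. norm (if j = i then h else 0)) F \<le> norm h"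
proof -
  assume F: "finite F"
  have "(\<Sum>j\<in>F. (norm (if j = i then h else 0))\<^sup>2) = (\<Sum>j\<in>F. if j = i then (norm h)\<^sup>2 else 0)"
    by (intro sum.cong) auto
  also have "\<dots> \<le> (norm h)\<^sup>2" using F by simp
  finally show ?thesis unfolding L2_set_def by (simp add: real_le_lsqrt)
qed

lemma l2_nth_single: "l2_nth (l2_single i h) j = (if j = i then h else 0)"
proof -
  have "square_summable (\<lambda>j. if j = i then h else 0)"
    by (rule square_summable_bound(1)[OF L2_set_single_le])
  then show ?thesis by (simp add: l2_single_def Abs_l2_inverse)
qed

lemma norm_l2_single_le: "norm (l2_single i h) \<le> norm h"
  unfolding norm_l2.rep_eq l2_nth_single
  by (rule square_summable_bound(2)[OF L2_set_single_le])

lemma norm_diag_op_le: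
  assumes "\<And>n. norm (a n) \<le> c"
  shows "norm (diag_op a) \<le> c"
  using assms order_trans[OF norm_ge_zero assms]
  by (auto intro!: norm_direct_sum_op_le order_trans[OF norm_blinfun_mult_right_le])

lemma norm_shift_le: "norm shift \<le> 1"
proof (rule norm_blinfun_bound)
  fix \<xi> :: "(nat, complex) l2"
  have "L2_set (\<lambda>n. norm (l2_nth (shift \<xi>) n)) F \<le> norm \<xi>" if "finite F" for F
  proof -
    let ?G = "(\<lambda>n. n - 1) ` (F - {0})"
    have "(\<Sum>n\<in>F. (norm (l2_nth (shift \<xi>) n))\<^sup>2) = (\<Sum>n\<in>F - {0}. (norm (l2_nth (shift \<xi>) n))\<^sup>2)"
      using that by (intro sum.mono_neutral_right) (auto simp: l2_nth_shift)
    also have "\<dots> = (\<Sum>n\<in>?G. (norm (l2_nth \<xi> n))\<^sup>2)"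
      by (subst sum.reindex)
         (auto simp: inj_on_def l2_nth_shift intro!: sum.cong split: nat.split_asm nat.split)
    finally have "L2_set (\<lambda>n. norm (l2_nth (shift \<xi>) n)) F = L2_set (\<lambda>n. norm (l2_nth \<xi> n)) ?G"
      by (simp add: L2_set_def)
    then show ?thesis using L2_set_le_norm_l2[of ?G \<xi>] that by simp
  qed
  then show "norm (shift \<xi>) \<le> 1 * norm \<xi>"
    unfolding norm_l2.rep_eq[of "shift \<xi>"] by (simp add: square_summable_bound(2))
qed simp

text \<open>The adjoint and a left inverse of \<open>shift\<close>; it serves to divide by the
  shift.\<close>

definition bshift :: "(nat, complex) l2 \<Rightarrow>\<^sub>L (nat, complex) l2" where
  "bshift = Blinfun (\<lambda>\<xi>. Abs_l2 (\<lambda>n. l2_nth \<xi> (Suc n)))"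

lemma l2_nth_bshift: "l2_nth (bshift \<xi>) n = l2_nth \<xi> (Suc n)"
proof -
  let ?g = "\<lambda>(\<xi> :: (nat, complex) l2) n. l2_nth \<xi> (Suc n)"
  have le: "L2_set (\<lambda>n. norm (?g \<xi> n)) F \<le> norm \<xi>" if "finite F" for F \<xi>
  proof -
    have "L2_set (\<lambda>n. norm (?g \<xi> n)) F = L2_set (\<lambda>n. norm (l2_nth \<xi> n)) (Suc ` F)"
      by (simp add: L2_set_def sum.reindex)
    then show ?thesis using L2_set_le_norm_l2 that by (metis finite_imageI)
  qed
  have nth: "l2_nth (Abs_l2 (?g \<xi>)) = ?g \<xi>" for \<xi>
    using square_summable_bound(1)[OF le] by (simp add: Abs_l2_inverse)
  have "bounded_linear (\<lambda>\<xi>. Abs_l2 (?g \<xi>))"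
  proof (rule bounded_linear_intro[where K = 1])
    show "Abs_l2 (?g (\<xi> + \<zeta>)) = Abs_l2 (?g \<xi>) + Abs_l2 (?g \<zeta>)" for \<xi> \<zeta>
      by (rule l2_eqI) (unfold nth, simp add: plus_l2.rep_eq nth)
    show "Abs_l2 (?g (r *\<^sub>R \<xi>)) = r *\<^sub>R Abs_l2 (?g \<xi>)" for r \<xi>
      by (rule l2_eqI) (unfold nth, simp add: scaleR_l2.rep_eq nth)
    show "norm (Abs_l2 (?g \<xi>)) \<le> norm \<xi> * 1" for \<xi>
      using square_summable_bound(2)[OF le[of _ \<xi>]] by (simp add: norm_l2.rep_eq nth)
  qed
  then show ?thesis
    unfolding bshift_def by (simp add: bounded_linear_Blinfun_apply nth)
qed

section \<open>Matrix entries of operators\<close>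

abbreviation entry :: "('a, (nat, complex) l2) l2 \<Rightarrow> 'a \<Rightarrow> nat \<Rightarrow> complex" where
  "entry \<xi> x n \<equiv> l2_nth (l2_nth \<xi> x) n"

lemma op_eqI:
  fixes S T :: "'a op"
  shows "(\<And>\<xi> x n. entry (S \<xi>) x n = entry (T \<xi>) x n) \<Longrightarrow> S = T"
  by (intro blinfun_eqI l2_eqI) auto

lemma entry_simps:
  "entry (\<xi> + \<zeta>) x n = entry \<xi> x n + entry \<zeta> x n"
  "entry (\<xi> - \<zeta>) x n = entry \<xi> x n - entry \<zeta> x n"
  "entry 0 x n = 0"
  by (simp_all add: plus_l2.rep_eq l2_nth_diff zero_l2.rep_eq)

lemma norm_entry_le: "norm (entry \<xi> x n) \<le> norm \<xi>"
  by (meson norm_l2_nth_le order_trans)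

lemma tendsto_entry: "(S \<longlongrightarrow> T) F \<Longrightarrow> ((\<lambda>k. entry (blinfun_apply (S k) \<xi>) x n) \<longlongrightarrow> entry (blinfun_apply T \<xi>) x n) F"
  by (intro bounded_linear.tendsto[OF bounded_linear_l2_nth] blinfun.tendsto tendsto_const)

definition basis_vec :: "'a \<Rightarrow> ('a, (nat, complex) l2) l2" where
  "basis_vec x = l2_single x (l2_single 0 1)"

lemma entry_basis_vec: "entry (basis_vec x) y n = (if y = x \<and> n = 0 then 1 else 0)"
  by (simp add: basis_vec_def l2_nth_single zero_l2.rep_eq)

lemma norm_basis_vec_le: "norm (basis_vec x) \<le> 1"
  unfolding basis_vec_def by (rule order_trans[OF norm_l2_single_le order_trans[OF norm_l2_single_le]]) simp

text \<open>The entry in row \<open>n\<close> and column zero of the block at \<open>x\<close>. For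
  a formal series with terms \<open>U^n f_n\<close> this is \<open>f_n(x)\<close>.\<close>

definition coef :: "nat \<Rightarrow> 'a op \<Rightarrow> 'a \<Rightarrow> complex" where
  "coef n T x = entry (T (basis_vec x)) x n"

lemma norm_coef_le: "norm (coef n T x) \<le> norm T"
proof -
  have "norm (coef n T x) \<le> norm (T (basis_vec x))" unfolding coef_def by (rule norm_entry_le)
  also have "\<dots> \<le> norm T * norm (basis_vec x)" by (rule norm_blinfun)
  also have "\<dots> \<le> norm T * 1" by (intro mult_left_mono norm_basis_vec_le) simp
  finally show ?thesis by simp
qed

lemma coef_add: "coef n (S + T) x = coef n S x + coef n T x"
  by (simp add: coef_def blinfun.add_left entry_simps)

lemma coef_diff: "coef n (S - T) x = coef n S x - coef n T x"
  by (simp add: coef_def blinfun.diff_left entry_simps)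

lemma coef_scaleC: "coef n (scaleC_op c T) x = c * coef n T x"
  by (simp add: coef_def l2_nth_scaleC_op)

lemma coef_zero: "coef n 0 x = 0"
  by (simp add: coef_def entry_simps)

lemma tendsto_coef: "(S \<longlongrightarrow> T) F \<Longrightarrow> ((\<lambda>k. coef n (S k) x) \<longlongrightarrow> coef n T x) F"
  unfolding coef_def by (rule tendsto_entry)

lemma norm_scalar_op_le: "norm (scalar_op c) \<le> norm c"
  unfolding scalar_op_def
  by (intro norm_direct_sum_op_le norm_blinfun_mult_right_le) auto

lemma norm_scaleC_op_le: "norm (scaleC_op c T) \<le> norm c * norm T"
  unfolding scaleC_op_def
  by (rule order_trans[OF norm_blinfun_compose]) (intro mult_right_mono norm_scalar_op_le norm_ge_zero)

lemma tendsto_blinfun_compose: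
  "(S \<longlongrightarrow> S') F \<Longrightarrow> (T \<longlongrightarrow> T') F \<Longrightarrow> ((\<lambda>k. S k o\<^sub>L T k) \<longlongrightarrow> S' o\<^sub>L T') F"
  by (rule bounded_bilinear.tendsto[OF bounded_bilinear_blinfun_compose])

lemma blinfun_compose_assoc: "(R o\<^sub>L S) o\<^sub>L T = R o\<^sub>L (S o\<^sub>L T)"
  by (rule blinfun_eqI) simp

lemma scaleC_minus_one: "scaleC_op (-1) T = - T"
  by (rule op_eqI) (simp add: l2_nth_scaleC_op blinfun.minus_left uminus_l2.rep_eq)

text \<open>The shift on all summands, and below it the backward shift. Both are auxiliary: neither
  need lie in the semicrossed product.\<close>

definition Ush :: "'a op" where "Ush = direct_sum_op UNIV (\<lambda>_. shift)"
definition Bsh :: "'a op" where "Bsh = direct_sum_op UNIV (\<lambda>_. bshift)"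

lemma entry_Ush: "entry (Ush \<xi>) x n = (case n of 0 \<Rightarrow> 0 | Suc m \<Rightarrow> entry \<xi> x m)"
  by (simp add: Ush_def l2_nth_direct_sum_op l2_nth_shift image_constant_conv)

lemma entry_Bsh: "entry (Bsh \<xi>) x n = entry \<xi> x (Suc n)"
  by (simp add: Bsh_def l2_nth_direct_sum_op l2_nth_bshift image_constant_conv)

text \<open>In general \<open>Ush o\<^sub>L Bsh\<close> erases exactly the zeroth
  coordinates.\<close>

lemma Ush_Bsh: "(\<And>x. entry \<xi> x 0 = 0) \<Longrightarrow> Ush (Bsh \<xi>) = \<xi>"
  by (intro l2_eqI) (auto simp: entry_Ush entry_Bsh split: nat.split)

section \<open>Functions vanishing at infinity\<close>

lemma C0_cong:
  assumes "f \<in> C0 X" "\<And>x. x \<in> topspace X \<Longrightarrow> f x = g x"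
  shows "g \<in> C0 X"
proof -
  have "continuous_map X euclidean g"
    using assms continuous_map_eq unfolding C0_def by blast
  then show ?thesis using assms unfolding C0_def by auto
qed

lemma C0_cont: "f \<in> C0 X \<Longrightarrow> continuous_map X euclidean f"
  by (simp add: C0_def)

lemma C0_vanish:
  assumes "f \<in> C0 X" "0 < e"
  obtains K where "compactin X K" "\<And>x. x \<in> topspace X - K \<Longrightarrow> norm (f x) < e"
  using assms unfolding C0_def by blast

lemma C0_bounded_mult:
  assumes f: "f \<in> C0 X" and g: "continuous_map X euclidean g"
    and b: "\<And>x. x \<in> topspace X \<Longrightarrow> norm (g x) \<le> c"
  shows "(\<lambda>x. g x * f x) \<in> C0 X"
proof -
  have "\<exists>K. compactin X K \<and> (\<forall>x\<in>topspace X - K. norm (g x * f x) < e)" if "e > 0" for e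
  proof -
    \<comment> \<open>The bound \<open>c\<close> may fail to be positive, while the threshold
      \<open>e / c'\<close> needs a positive denominator.\<close>
    define c' where "c' = max c 1"
    have c': "c' > 0" by (simp add: c'_def)
    obtain K where K: "compactin X K" "\<And>x. x \<in> topspace X - K \<Longrightarrow> norm (f x) < e / c'"
      using C0_vanish[OF f divide_pos_pos[OF \<open>e > 0\<close> c']] by metis
    have "norm (g x * f x) < e" if x: "x \<in> topspace X - K" for x
    proof -
      have "norm (g x * f x) \<le> c' * norm (f x)"
        using b[of x] x by (auto simp: norm_mult c'_def intro!: mult_right_mono)
      also have "\<dots> < e" using K(2)[OF x] c' by (simp add: field_simps)
      finally show ?thesis .
    qed
    then show ?thesis using K by blast
  qed
  moreover have "continuous_map X euclidean (\<lambda>x. g x * f x)"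
    using f g by (simp add: C0_def continuous_map_atin tendsto_mult)
  ultimately show ?thesis by (simp add: C0_def)
qed

lemma C0_mult: "f \<in> C0 X \<Longrightarrow> g \<in> C0 X \<Longrightarrow> (\<lambda>x. f x * g x) \<in> C0 X"
  by (metis C0_bounded_mult C0_cont bounded_C0)

lemma C0_cmult: "f \<in> C0 X \<Longrightarrow> (\<lambda>x. c * f x) \<in> C0 X"
  by (rule C0_bounded_mult[of f X "\<lambda>_. c" "norm c"]) auto

lemma C0_add:
  assumes "f \<in> C0 X" "g \<in> C0 X"
  shows "(\<lambda>x. f x + g x) \<in> C0 X"
proof -
  have "\<exists>K. compactin X K \<and> (\<forall>x\<in>topspace X - K. norm (f x + g x) < e)" if "e > 0" for e
  proof -
    obtain K where K: "compactin X K" "\<And>x. x \<in> topspace X - K \<Longrightarrow> norm (f x) < e / 2"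
      using C0_vanish[OF assms(1) half_gt_zero[OF \<open>e > 0\<close>]] by metis
    obtain L where L: "compactin X L" "\<And>x. x \<in> topspace X - L \<Longrightarrow> norm (g x) < e / 2"
      using C0_vanish[OF assms(2) half_gt_zero[OF \<open>e > 0\<close>]] by metis
    have "norm (f x + g x) < e" if "x \<in> topspace X - (K \<union> L)" for x
      using K(2)[of x] L(2)[of x] that norm_triangle_ineq[of "f x" "g x"] by auto
    then show ?thesis using compactin_Un[OF K(1) L(1)] by blast
  qed
  then show ?thesis using assms by (auto simp: C0_def intro!: continuous_intros)
qed

lemma C0_zero: "(\<lambda>_. 0) \<in> C0 X"
  by (auto simp: C0_def intro: exI[of _ "{}"])

lemma C0_sum: "(\<And>i. i \<in> I \<Longrightarrow> f i \<in> C0 X) \<Longrightarrow> (\<lambda>x. \<Sum>i\<in>I. f i x) \<in> C0 X"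
  by (induction I rule: infinite_finite_induct) (auto simp: C0_zero intro: C0_add)

lemma C0_diff: "f \<in> C0 X \<Longrightarrow> g \<in> C0 X \<Longrightarrow> (\<lambda>x. f x - g x) \<in> C0 X"
  using C0_add[of f X "\<lambda>x. (-1) * g x"] C0_cmult[of g X "-1"] by simp

lemma C0_norm_comp:
  assumes f: "f \<in> C0 X" and h: "continuous_on UNIV h" "\<And>z. norm (h z) = norm (z::complex)"
  shows "(\<lambda>x. h (f x)) \<in> C0 X"
proof -
  have "continuous_map X euclidean (h \<circ> f)"
    using f h by (intro continuous_map_compose[of X euclidean]) (auto simp: C0_def)
  then show ?thesis using f h unfolding C0_def o_def by auto
qed

lemma C0_cnj: "f \<in> C0 X \<Longrightarrow> (\<lambda>x. cnj (f x)) \<in> C0 X"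
  by (rule C0_norm_comp) (auto intro: continuous_intros)

text \<open>Both factors, \<open>f / sqrt |f|\<close> and \<open>sqrt |f|\<close>, have modulus
  \<open>sqrt |f|\<close> and therefore vanish at infinity along with \<open>f\<close>. The
  factorization makes up for a missing unit in \<open>character_emb_nonzero\<close>.\<close>

lemma C0_factor:
  assumes f: "f \<in> C0 X"
  obtains g h where "g \<in> C0 X" "h \<in> C0 X" "\<And>x. f x = g x * h x"
proof -
  let ?h = "\<lambda>x. complex_of_real (sqrt (norm (f x)))"
  let ?g = "\<lambda>x. f x / complex_of_real (sqrt (norm (f x)))"
  have sq: "(norm (?h x)) = sqrt (norm (f x))" "norm (?g x) = sqrt (norm (f x))" for x
    by (auto simp: norm_divide real_div_sqrt)
  have van: "\<exists>K. compactin X K \<and> (\<forall>x\<in>topspace X - K. sqrt (norm (f x)) < e)" if "e > 0" for e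
  proof -
    obtain K where K: "compactin X K" "\<And>x. x \<in> topspace X - K \<Longrightarrow> norm (f x) < e\<^sup>2"
      using C0_vanish[OF f zero_less_power[OF \<open>e > 0\<close>]] by metis
    then show ?thesis using that by (auto intro!: exI[of _ K] real_less_lsqrt)
  qed
  have ch: "continuous_map X euclidean ?h"
  proof -
    have "continuous_on UNIV (\<lambda>z::complex. complex_of_real (sqrt (norm z)))"
      by (intro continuous_intros)
    then show ?thesis
      using continuous_map_compose[of X euclidean f euclidean "\<lambda>z. complex_of_real (sqrt (norm z))"] f
      by (simp add: C0_def o_def)
  qed
  have "?h \<in> C0 X" using van ch by (simp add: C0_def sq)
  \<comment> \<open>At zero the quotient takes the value 0 by the convention for division, and its
    modulus \<open>sqrt (norm z)\<close> gives continuity there.\<close>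
  have "continuous_on UNIV (\<lambda>z::complex. z / complex_of_real (sqrt (norm z)))"
    unfolding continuous_on_eq_continuous_at[OF open_UNIV]
  proof safe
    fix z :: complex
    show "isCont (\<lambda>z. z / complex_of_real (sqrt (norm z))) z"
    proof (cases "z = 0")
      case False
      then show ?thesis by (intro continuous_intros) auto
    next
      case True
      have "((\<lambda>z::complex. z / complex_of_real (sqrt (norm z))) \<longlongrightarrow> 0) (at 0)"
      proof (rule Lim_null_comparison[where g = "\<lambda>z. sqrt (norm z)"])
        show "\<forall>\<^sub>F x in at 0. norm (x / complex_of_real (sqrt (norm x))) \<le> sqrt (norm (x::complex))"
          by (simp add: norm_divide real_div_sqrt)
        have "((\<lambda>x::complex. sqrt (norm x)) \<longlongrightarrow> sqrt (norm (0::complex))) (at 0)"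
          by (intro tendsto_intros)
        then show "((\<lambda>x::complex. sqrt (norm x)) \<longlongrightarrow> 0) (at 0)" by simp
      qed
      then show ?thesis using True by (simp add: isCont_def)
    qed
  qed
  then have "continuous_map X euclidean ?g"
    using continuous_map_compose[of X euclidean f euclidean "\<lambda>z. z / complex_of_real (sqrt (norm z))"] f
    by (simp add: C0_def o_def)
  then have "?g \<in> C0 X" using van by (simp add: C0_def sq)
  moreover have "f x = ?g x * ?h x" for x by simp
  ultimately show ?thesis using \<open>?h \<in> C0 X\<close> that by blast
qed

lemma C0_uniform_limit:
  assumes f: "\<And>n. f n \<in> C0 X" and lim: "\<And>e. e > 0 \<Longrightarrow> \<exists>n::nat. \<forall>x\<in>topspace X. norm (f n x - g x) < e"
  shows "g \<in> C0 X"
proof -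
  have "\<forall>k::nat. \<exists>n. \<forall>x\<in>topspace X. norm (f n x - g x) < inverse (Suc k)"
    using lim by simp
  then obtain n where n: "\<And>k x. x \<in> topspace X \<Longrightarrow> norm (f (n k) x - g x) < inverse (Suc k)"
    by metis
  have "continuous_map X euclidean g"
  proof (rule Met_TC.continuous_map_uniform_limit[where F = sequentially and f = "\<lambda>k. f (n k)",
        unfolded mtopology_is_euclidean])
    show "\<forall>\<^sub>F x in sequentially. continuous_map X euclidean (f (n x))"
      using f by (simp add: C0_def)
    show "\<forall>\<^sub>F k in sequentially. \<forall>x\<in>topspace X. g x \<in> UNIV \<and> dist (f (n k) x) (g x) < e"
      if "0 < e" for e
    proof -
      obtain N where "inverse (Suc N) < e" using reals_Archimedean[OF \<open>0 < e\<close>] by auto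
      have "inverse (real (Suc k)) < e" if "k \<ge> N" for k
      proof -
        have "inverse (real (Suc k)) \<le> inverse (real (Suc N))"
          by (rule le_imp_inverse_le) (use that in auto)
        then show ?thesis using \<open>inverse (Suc N) < e\<close> by linarith
      qed
      then show ?thesis using n unfolding eventually_sequentially dist_norm
        by (intro exI[of _ N] allI impI ballI conjI UNIV_I) (rule less_trans, assumption, blast)
    qed
  qed (rule trivial_limit_sequentially)
  moreover have "\<exists>K. compactin X K \<and> (\<forall>x\<in>topspace X - K. norm (g x) < e)" if "e > 0" for e
  proof -
    obtain m where m: "\<And>x. x \<in> topspace X \<Longrightarrow> norm (f m x - g x) < e / 2"
      using lim[OF half_gt_zero[OF \<open>e > 0\<close>]] by blast
    obtain K where K: "compactin X K" "\<And>x. x \<in> topspace X - K \<Longrightarrow> norm (f m x) < e / 2"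
      using C0_vanish[OF f[of m] half_gt_zero[OF \<open>e > 0\<close>]] by metis
    have "norm (g x) < e" if "x \<in> topspace X - K" for x
      using m[of x] K(2)[of x] that norm_triangle_ineq4[of "f m x" "f m x - g x"] by auto
    then show ?thesis using K by blast
  qed
  ultimately show ?thesis by (simp add: C0_def)
qed

text \<open>Locally compact Hausdorff spaces are completely regular, and a compact neighbourhood of
  \<open>x\<close> makes the bump vanish at infinity. Real values are recorded for the later
  argument with holomorphic functions on discs.\<close>

lemma C0_separation:
  assumes "locally_compact_space X" "Hausdorff_space X" "openin X U" "x \<in> U"
  obtains f where "f \<in> C0 X" "f x = 1" "\<And>y. y \<in> topspace X - U \<Longrightarrow> f y = 0"
    "\<And>y. y \<in> topspace X \<Longrightarrow> norm (f y) \<le> 1" "\<And>y. f y \<in> \<real>"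
proof -
  have xX: "x \<in> topspace X" using assms openin_subset by blast
  obtain V K where VK: "openin X V" "compactin X K" "x \<in> V" "V \<subseteq> K"
    using assms(1) xX unfolding locally_compact_space_def by blast
  have cr: "completely_regular_space X"
    using assms locally_compact_Hausdorff_imp_regular_space locally_compact_regular_imp_completely_regular_space by blast
  \<comment> \<open>Cutting \<open>U\<close> down to \<open>V\<close>, which lies inside the compact
    \<open>K\<close>, forces the bump to vanish off \<open>K\<close>.\<close>
  define S where "S = topspace X - (U \<inter> V)"
  have "closedin X S" "x \<in> topspace X - S"
    using assms VK xX by (auto simp: S_def)
  then obtain f where f: "continuous_map X (top_of_set {0..1::real}) f" "f x = 0" "f ` S \<subseteq> {1}"
    using cr unfolding completely_regular_space_def by blast
  have fc: "continuous_map X euclideanreal f"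
    using f(1) continuous_map_into_fulltopology by blast
  have fr: "0 \<le> f y" "f y \<le> 1" if "y \<in> topspace X" for y
    using continuous_map_image_subset_topspace[OF f(1)] that by (auto simp: image_subset_iff)
  let ?g = "\<lambda>y. complex_of_real (1 - f y)"
  show ?thesis
  proof (rule that)
    have 0: "?g y = 0" if "y \<in> topspace X - (U \<inter> V)" for y
      using f(3) that by (auto simp: S_def)
    then show "?g y = 0" if "y \<in> topspace X - U" for y using that by auto
    have "continuous_map X euclidean (complex_of_real \<circ> (\<lambda>y. 1 - f y))"
      using fc by (intro continuous_map_compose[of X euclideanreal] continuous_intros)
         (auto simp: continuous_on_of_real)
    then have "continuous_map X euclidean ?g" by (simp add: o_def)
    moreover have "\<forall>y\<in>topspace X - K. norm (?g y) < e" if "e > 0" for e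
      using 0 VK that by fastforce
    ultimately show "?g \<in> C0 X" using VK(2) by (auto simp: C0_def)
    show "?g x = 1" by (simp add: f)
    show "norm (?g y) \<le> 1" if "y \<in> topspace X" for y
      using fr[OF that] by (simp flip: of_real_diff)
    show "?g y \<in> \<real>" for y by simp
  qed
qed

text \<open>Properness preserves vanishing at infinity, because preimages of compact sets are
  compact.\<close>

lemma C0_comp:
  assumes f: "f \<in> C0 Y" and h: "continuous_map X Y h" "proper_map X Y h"
  shows "(\<lambda>x. f (h x)) \<in> C0 X"
proof -
  have "continuous_map X euclidean (f \<circ> h)"
    using f h by (auto simp: C0_def intro: continuous_map_compose)
  moreover have "\<exists>K. compactin X K \<and> (\<forall>x\<in>topspace X - K. norm (f (h x)) < e)" if "e > 0" for e
  proof -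
    obtain K where K: "compactin Y K" "\<And>x. x \<in> topspace Y - K \<Longrightarrow> norm (f x) < e"
      using C0_vanish[OF f \<open>e > 0\<close>] by metis
    have "compactin X {x \<in> topspace X. h x \<in> K}"
      using h(2) K(1) compactin_proper_map_preimage by blast
    moreover have "norm (f (h x)) < e" if "x \<in> topspace X - {x \<in> topspace X. h x \<in> K}" for x
      using K(2)[of "h x"] that h(1) by (auto simp: continuous_map_def)
    ultimately show ?thesis by blast
  qed
  ultimately show ?thesis by (simp add: C0_def o_def)
qed

section \<open>Fourier coefficients in the semicrossed product\<close>

lemma semicrossed_product_closed_subalgebra:
  "operator_subalgebra (semicrossed_product X \<eta>) \<and> closed (semicrossed_product X \<eta>)"
  unfolding semicrossed_product_def
proof (rule hull_in[where S = "\<lambda>A. operator_subalgebra A \<and> closed A"])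
  fix \<A> :: "'a op set set"
  assume "\<forall>A\<in>\<A>. operator_subalgebra A \<and> closed A"
  then show "operator_subalgebra (\<Inter>\<A>) \<and> closed (\<Inter>\<A>)"
    unfolding operator_subalgebra_def by (auto intro!: closed_Inter)
qed

section \<open>A single dynamical system, its generators and induction over the algebra\<close>

locale dyn_system =
  fixes X :: "'a topology" and \<eta> :: "'a \<Rightarrow> 'a"
  assumes lc: "locally_compact_space X" and haus: "Hausdorff_space X"
    and cont: "continuous_map X X \<eta>" and proper: "proper_map X X \<eta>"
begin

abbreviation A :: "'a op set" where "A \<equiv> semicrossed_product X \<eta>"

definition emb :: "('a \<Rightarrow> complex) \<Rightarrow> 'a op" where
  "emb f = direct_sum_op (topspace X) (\<lambda>x. pi_rep \<eta> f x)"

definition uemb :: "('a \<Rightarrow> complex) \<Rightarrow> 'a op" where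
  "uemb g = direct_sum_op (topspace X) (\<lambda>x. shift o\<^sub>L pi_rep \<eta> g x)"

lemma entry_emb: "f \<in> C0 X \<Longrightarrow>
  entry (emb f \<xi>) x n = (if x \<in> topspace X then f ((\<eta> ^^ n) x) * entry \<xi> x n else 0)"
  unfolding emb_def by (rule generator_apply[OF cont])

lemma entry_uemb: "f \<in> C0 X \<Longrightarrow>
  entry (uemb f \<xi>) x n
     = (if x \<in> topspace X then (case n of 0 \<Rightarrow> 0 | Suc m \<Rightarrow> f ((\<eta> ^^ m) x) * entry \<xi> x m) else 0)"
  unfolding uemb_def by (rule shift_generator_apply[OF cont])

lemma eta_in: "x \<in> topspace X \<Longrightarrow> \<eta> x \<in> topspace X"
  using cont by (auto simp: continuous_map_def Pi_iff)

lemma iter_in: "x \<in> topspace X \<Longrightarrow> (\<eta> ^^ n) x \<in> topspace X"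
  by (induction n) (auto simp: eta_in)

lemma C0_eta: "f \<in> C0 X \<Longrightarrow> (\<lambda>x. f (\<eta> x)) \<in> C0 X"
  by (rule C0_comp[OF _ cont proper])

lemma C0_iter: "f \<in> C0 X \<Longrightarrow> (\<lambda>x. f ((\<eta> ^^ n) x)) \<in> C0 X"
proof (induction n arbitrary: f)
  case (Suc n)
  show ?case using Suc.IH[OF C0_eta[OF Suc.prems]] by simp
qed simp

lemma emb_in: "f \<in> C0 X \<Longrightarrow> emb f \<in> A"
  unfolding semicrossed_product_def
  by (rule hull_inc) (auto simp: semicrossed_generators_def emb_def)

lemma uemb_in: "f \<in> C0 X \<Longrightarrow> uemb f \<in> A"
  unfolding semicrossed_product_def
  by (rule hull_inc) (auto simp: semicrossed_generators_def uemb_def)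

lemma A_subalg: "operator_subalgebra A" and A_closed: "closed A"
  using semicrossed_product_closed_subalgebra by blast+

lemma A_zero: "0 \<in> A"
  and A_add: "S \<in> A \<Longrightarrow> T \<in> A \<Longrightarrow> S + T \<in> A"
  and A_scale: "T \<in> A \<Longrightarrow> scaleC_op c T \<in> A"
  and A_mult: "S \<in> A \<Longrightarrow> T \<in> A \<Longrightarrow> S o\<^sub>L T \<in> A"
  using A_subalg unfolding operator_subalgebra_def by blast+

lemma A_diff: "S \<in> A \<Longrightarrow> T \<in> A \<Longrightarrow> S - T \<in> A"
  using A_add[OF _ A_scale[of T "-1"], of S] by (simp add: scaleC_minus_one)

lemma A_limit: "(\<And>n::nat. S n \<in> A) \<Longrightarrow> S \<longlonglongrightarrow> T \<Longrightarrow> T \<in> A"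
  using A_closed unfolding closed_sequential_limits by blast

text \<open>The members of the algebra that satisfy \<open>P\<close> form a closed subalgebra
  containing the generators, so minimality of the hull applies. Sequences are enough for closedness
  in a metric space.\<close>

lemma A_induct [consumes 1, case_names emb uemb zero add scale mult lim]:
  assumes "T \<in> A"
    and "\<And>f. f \<in> C0 X \<Longrightarrow> P (emb f)"
    and "\<And>f. f \<in> C0 X \<Longrightarrow> P (uemb f)"
    and "P 0"
    and "\<And>S T. S \<in> A \<Longrightarrow> P S \<Longrightarrow> T \<in> A \<Longrightarrow> P T \<Longrightarrow> P (S + T)"
    and "\<And>c T. T \<in> A \<Longrightarrow> P T \<Longrightarrow> P (scaleC_op c T)"
    and "\<And>S T. S \<in> A \<Longrightarrow> P S \<Longrightarrow> T \<in> A \<Longrightarrow> P T \<Longrightarrow> P (S o\<^sub>L T)"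
    and "\<And>S T. (\<And>n::nat. S n \<in> A) \<Longrightarrow> (\<And>n. P (S n)) \<Longrightarrow> T \<in> A \<Longrightarrow> S \<longlonglongrightarrow> T \<Longrightarrow> P T"
  shows "P T"
proof -
  have "semicrossed_generators X \<eta> \<subseteq> {T \<in> A. P T}"
    using assms(2,3) emb_in uemb_in unfolding semicrossed_generators_def emb_def uemb_def by auto
  moreover have "operator_subalgebra {T \<in> A. P T}"
    unfolding operator_subalgebra_def using assms(4-7) A_zero A_add A_scale A_mult by auto
  moreover have "closed {T \<in> A. P T}"
    unfolding closed_sequential_limits
  proof safe
    fix S T assume S: "\<forall>n. S n \<in> {T \<in> A. P T}" "S \<longlonglongrightarrow> T"
    then show "T \<in> A" using A_closed unfolding closed_sequential_limits by blast
    then show "P T" using assms(8)[of S T] S by blast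
  qed
  ultimately have "A \<subseteq> {T \<in> A. P T}"
    using hull_minimal[where S = "\<lambda>A. operator_subalgebra A \<and> closed A"]
    by (metis (no_types, lifting) semicrossed_product_def)
  then show ?thesis using assms(1) by blast
qed

lemma coef_emb: "f \<in> C0 X \<Longrightarrow> x \<in> topspace X \<Longrightarrow> coef n (emb f) x = (if n = 0 then f x else 0)"
  by (simp add: coef_def entry_emb entry_basis_vec)

lemma coef_uemb: "f \<in> C0 X \<Longrightarrow> x \<in> topspace X \<Longrightarrow> coef n (uemb f) x = (if n = 1 then f x else 0)"
  by (auto simp: coef_def entry_uemb entry_basis_vec split: nat.split)

text \<open>Each coefficient \<open>f\<^sub>n\<close> already determines the \<open>n\<close>-th subdiagonal, with entries \<open>f\<^sub>n \<circ> \<eta>\<^sup>m\<close>.\<close>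

definition toep :: "'a op \<Rightarrow> bool" where
  "toep T \<longleftrightarrow> (\<forall>n. coef n T \<in> C0 X) \<and> (\<forall>\<xi> x k. entry (T \<xi>) x k =
     (if x \<in> topspace X then \<Sum>m\<le>k. coef (k - m) T ((\<eta> ^^ m) x) * entry \<xi> x m else 0))"

lemma toepI:
  assumes "\<And>n. coef n T \<in> C0 X"
    and "\<And>\<xi> x k. x \<in> topspace X \<Longrightarrow>
      entry (T \<xi>) x k = (\<Sum>m\<le>k. coef (k - m) T ((\<eta> ^^ m) x) * entry \<xi> x m)"
    and "\<And>\<xi> x k. x \<notin> topspace X \<Longrightarrow> entry (T \<xi>) x k = 0"
  shows "toep T"
  using assms unfolding toep_def by simp

lemma toep_emb:
  assumes f: "f \<in> C0 X"
  shows "toep (emb f)"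
proof (rule toepI)
  show "coef n (emb f) \<in> C0 X" for n
    by (rule C0_cong[of "if n = 0 then f else (\<lambda>_. 0)"]) (auto simp: coef_emb f C0_zero)
  fix \<xi> x k assume x: "x \<in> topspace X"
  have "(\<Sum>m\<le>k. coef (k - m) (emb f) ((\<eta> ^^ m) x) * entry \<xi> x m)
      = (\<Sum>m\<le>k. if m = k then f ((\<eta> ^^ m) x) * entry \<xi> x m else 0)"
    by (intro sum.cong) (auto simp: coef_emb f iter_in x)
  then show "entry (emb f \<xi>) x k = (\<Sum>m\<le>k. coef (k - m) (emb f) ((\<eta> ^^ m) x) * entry \<xi> x m)"
    by (simp add: entry_emb f x)
qed (simp add: entry_emb f)

lemma toep_uemb:
  assumes f: "f \<in> C0 X"
  shows "toep (uemb f)"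
proof (rule toepI)
  show "coef n (uemb f) \<in> C0 X" for n
    by (rule C0_cong[of "if n = 1 then f else (\<lambda>_. 0)"]) (auto simp: coef_uemb f C0_zero)
  fix \<xi> x k assume x: "x \<in> topspace X"
  have "(\<Sum>m\<le>k. coef (k - m) (uemb f) ((\<eta> ^^ m) x) * entry \<xi> x m)
      = (\<Sum>m\<le>k. if Suc m = k then f ((\<eta> ^^ m) x) * entry \<xi> x m else 0)"
    by (intro sum.cong) (auto simp: coef_uemb f iter_in x)
  also have "\<dots> = (case k of 0 \<Rightarrow> 0 | Suc m \<Rightarrow> f ((\<eta> ^^ m) x) * entry \<xi> x m)"
    by (cases k) auto
  finally show "entry (uemb f \<xi>) x k = (\<Sum>m\<le>k. coef (k - m) (uemb f) ((\<eta> ^^ m) x) * entry \<xi> x m)"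
    by (simp add: entry_uemb f x)
qed (simp add: entry_uemb f)

text \<open>This is a convolution twisted by the dynamics: moving a function to the right past
  \<open>U^m\<close> composes it with the \<open>m\<close>-th iterate.\<close>

lemma coef_compose_toep:
  assumes "toep S" "x \<in> topspace X"
  shows "coef n (S o\<^sub>L T) x = (\<Sum>m\<le>n. coef (n - m) S ((\<eta> ^^ m) x) * coef m T x)"
  using assms by (simp add: toep_def coef_def)

lemma toep_compose:
  assumes S: "toep S" and T: "toep T"
  shows "toep (S o\<^sub>L T)"
proof (rule toepI)
  fix n
  have "(\<lambda>x. \<Sum>m\<le>n. coef (n - m) S ((\<eta> ^^ m) x) * coef m T x) \<in> C0 X"
    using S T unfolding toep_def by (intro C0_sum C0_mult C0_iter) auto
  then show "coef n (S o\<^sub>L T) \<in> C0 X"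
    by (rule C0_cong) (simp add: coef_compose_toep S)
next
  fix \<xi> x k assume x: "x \<in> topspace X"
  \<comment> \<open>Here \<open>j\<close> is the column and \<open>i\<close> the degree contributed
    by \<open>T\<close>. The intermediate index is \<open>m = i + j\<close>, and the triangular
    double sum is reordered to sum over \<open>i\<close> first.\<close>
  define G where "G = (\<lambda>j i. coef (k - j - i) S ((\<eta> ^^ (i + j)) x) * coef i T ((\<eta> ^^ j) x) * entry \<xi> x j)"
  have "entry ((S o\<^sub>L T) \<xi>) x k
      = (\<Sum>m\<le>k. coef (k - m) S ((\<eta> ^^ m) x) * (\<Sum>j\<le>m. coef (m - j) T ((\<eta> ^^ j) x) * entry \<xi> x j))"
    using S T x by (simp add: toep_def)
  also have "\<dots> = (\<Sum>m\<le>k. \<Sum>j\<le>m. G j (m - j))"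
    by (auto simp: sum_distrib_left G_def intro!: sum.cong)
  also have "\<dots> = (\<Sum>(j,i)\<in>{(j,i). j + i \<le> k}. G j i)"
    by (rule sum.triangle_reindex_eq[symmetric])
  also have "{(j,i). j + i \<le> k} = (SIGMA j:{..k}. {..k - j})" by auto
  also have "(\<Sum>(j,i)\<in>(SIGMA j:{..k}. {..k - j}). G j i) = (\<Sum>j\<le>k. \<Sum>i\<le>k - j. G j i)"
    by (simp add: sum.Sigma)
  also have "\<dots> = (\<Sum>j\<le>k. coef (k - j) (S o\<^sub>L T) ((\<eta> ^^ j) x) * entry \<xi> x j)"
    by (auto simp: coef_compose_toep S iter_in x G_def sum_distrib_right funpow_add intro!: sum.cong)
  finally show "entry ((S o\<^sub>L T) \<xi>) x k
      = (\<Sum>m\<le>k. coef (k - m) (S o\<^sub>L T) ((\<eta> ^^ m) x) * entry \<xi> x m)" .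
qed (use S in \<open>simp add: toep_def\<close>)

text \<open>The matrix form survives sums, products and norm limits. For limits,
  \<open>norm_coef_le\<close> bounds each coefficient independently of the point, so coefficients
  converge uniformly and stay in \<open>C0 X\<close>.\<close>

lemma toep_A: "T \<in> A \<Longrightarrow> toep T"
proof (induction rule: A_induct)
  case zero
  show ?case
  proof (rule toepI)
    show "coef n 0 \<in> C0 X" for n
      by (rule C0_cong[OF C0_zero]) (simp add: coef_zero)
  qed (simp_all add: coef_zero entry_simps)
next
  case (add S T)
  then have toep: "toep S" "toep T" by blast+
  show ?case
  proof (rule toepI)
    show "coef n (S + T) \<in> C0 X" for n
      by (rule C0_cong[OF C0_add[of "coef n S" X "coef n T"]]) (use toep in \<open>simp_all add: toep_def coef_add\<close>)
  qed (use toep in \<open>simp_all add: toep_def coef_add blinfun.add_left entry_simps distrib_right sum.distrib\<close>)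
next
  case (scale c T)
  then have toep: "toep T" by blast
  show ?case
  proof (rule toepI)
    show "coef n (scaleC_op c T) \<in> C0 X" for n
      by (rule C0_cong[OF C0_cmult[of "coef n T" X c]]) (use toep in \<open>simp_all add: toep_def coef_scaleC\<close>)
  qed (use toep in \<open>simp_all add: toep_def coef_scaleC l2_nth_scaleC_op sum_distrib_left mult.assoc\<close>)
next
  case (lim S T)
  have toep: "toep (S n)" for n using lim by blast
  show ?case
  proof (rule toepI)
    fix n
    show "coef n T \<in> C0 X"
    proof (rule C0_uniform_limit[of "\<lambda>k. coef n (S k)"])
      fix e :: real assume "e > 0"
      then obtain k where k: "norm (S k - T) < e"
        using \<open>S \<longlonglongrightarrow> T\<close> unfolding LIMSEQ_iff by blast
      have "norm (coef n (S k) x - coef n T x) < e" for x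
        using order.strict_trans1[OF norm_coef_le k] by (simp add: coef_diff)
      then show "\<exists>k. \<forall>x\<in>topspace X. norm (coef n (S k) x - coef n T x) < e" by blast
    qed (use toep in \<open>simp add: toep_def\<close>)
  next
    fix \<xi> x k assume x: "x \<in> topspace X"
    have "(\<lambda>j. entry (S j \<xi>) x k) \<longlonglongrightarrow> (\<Sum>m\<le>k. coef (k - m) T ((\<eta> ^^ m) x) * entry \<xi> x m)"
    proof -
      have "(\<lambda>j. entry (S j \<xi>) x k)
          = (\<lambda>j. \<Sum>m\<le>k. coef (k - m) (S j) ((\<eta> ^^ m) x) * entry \<xi> x m)"
        using toep x by (simp add: toep_def)
      then show ?thesis
        by (simp only:) (intro tendsto_sum tendsto_mult tendsto_const tendsto_coef \<open>S \<longlonglongrightarrow> T\<close>)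
    qed
    then show "entry (T \<xi>) x k = (\<Sum>m\<le>k. coef (k - m) T ((\<eta> ^^ m) x) * entry \<xi> x m)"
      using LIMSEQ_unique tendsto_entry[OF \<open>S \<longlonglongrightarrow> T\<close>] by blast
  next
    fix \<xi> x k assume x: "x \<notin> topspace X"
    have "(\<lambda>j. entry (S j \<xi>) x k) \<longlonglongrightarrow> 0"
      using toep x unfolding toep_def by simp
    then show "entry (T \<xi>) x k = 0"
      using LIMSEQ_unique tendsto_entry[OF \<open>S \<longlonglongrightarrow> T\<close>] by blast
  qed
qed (auto intro: toep_emb toep_uemb toep_compose)

lemma coef_C0: "T \<in> A \<Longrightarrow> coef n T \<in> C0 X"
  using toep_A by (simp add: toep_def)

lemma entry_A: "T \<in> A \<Longrightarrow> x \<in> topspace X \<Longrightarrow>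
    entry (T \<xi>) x k = (\<Sum>m\<le>k. coef (k - m) T ((\<eta> ^^ m) x) * entry \<xi> x m)"
  and entry_A_outside: "T \<in> A \<Longrightarrow> x \<notin> topspace X \<Longrightarrow> entry (T \<xi>) x k = 0"
  using toep_A by (simp_all add: toep_def)

lemma coef_compose:
  "S \<in> A \<Longrightarrow> x \<in> topspace X \<Longrightarrow>
    coef n (S o\<^sub>L T) x = (\<Sum>m\<le>n. coef (n - m) S ((\<eta> ^^ m) x) * coef m T x)"
  by (rule coef_compose_toep[OF toep_A])

lemma emb_cong: "f \<in> C0 X \<Longrightarrow> (\<And>x. x \<in> topspace X \<Longrightarrow> f x = g x) \<Longrightarrow> emb f = emb g"
  by (rule op_eqI) (auto simp: entry_emb iter_in C0_cong[of f])

lemma emb_add: "f \<in> C0 X \<Longrightarrow> g \<in> C0 X \<Longrightarrow> emb (\<lambda>x. f x + g x) = emb f + emb g"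
  by (rule op_eqI) (auto simp: entry_emb C0_add entry_simps blinfun.add_left distrib_right)

lemma emb_diff: "f \<in> C0 X \<Longrightarrow> g \<in> C0 X \<Longrightarrow> emb (\<lambda>x. f x - g x) = emb f - emb g"
  by (rule op_eqI) (auto simp: entry_emb C0_diff entry_simps blinfun.diff_left left_diff_distrib)

lemma emb_mult: "f \<in> C0 X \<Longrightarrow> g \<in> C0 X \<Longrightarrow> emb (\<lambda>x. f x * g x) = emb f o\<^sub>L emb g"
  by (rule op_eqI) (auto simp: entry_emb C0_mult)

lemma emb_scale: "f \<in> C0 X \<Longrightarrow> emb (\<lambda>x. c * f x) = scaleC_op c (emb f)"
  by (rule op_eqI) (auto simp: entry_emb C0_cmult l2_nth_scaleC_op)

lemma uemb_emb: "f \<in> C0 X \<Longrightarrow> g \<in> C0 X \<Longrightarrow> uemb f o\<^sub>L emb g = uemb (\<lambda>x. f x * g x)"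
  by (rule op_eqI) (auto simp: entry_emb entry_uemb C0_mult split: nat.split)

lemma emb_uemb: "f \<in> C0 X \<Longrightarrow> g \<in> C0 X \<Longrightarrow> emb f o\<^sub>L uemb g = uemb (\<lambda>x. f (\<eta> x) * g x)"
  by (rule op_eqI) (auto simp: entry_emb entry_uemb C0_mult C0_eta split: nat.split)

lemma emb_Ush: "f \<in> C0 X \<Longrightarrow> emb f o\<^sub>L Ush = uemb (\<lambda>x. f (\<eta> x))"
  by (rule op_eqI) (auto simp: entry_emb entry_uemb C0_eta entry_Ush split: nat.split)

lemma norm_pi_rep_le:
  assumes "\<And>x. x \<in> topspace X \<Longrightarrow> norm (f x) \<le> c" "x \<in> topspace X"
  shows "norm (pi_rep \<eta> f x) \<le> c"
  unfolding pi_rep_def by (rule norm_diag_op_le) (simp add: assms iter_in)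

lemma norm_emb_le:
  assumes "\<And>x. x \<in> topspace X \<Longrightarrow> norm (f x) \<le> c" "0 \<le> c"
  shows "norm (emb f) \<le> c"
  unfolding emb_def using assms by (intro norm_direct_sum_op_le norm_pi_rep_le)

lemma norm_uemb_le:
  assumes "\<And>x. x \<in> topspace X \<Longrightarrow> norm (f x) \<le> c" "0 \<le> c"
  shows "norm (uemb f) \<le> c"
proof -
  have "norm (shift o\<^sub>L pi_rep \<eta> f x) \<le> 1 * c" if "x \<in> topspace X" for x
    using norm_pi_rep_le[OF assms(1) that] norm_shift_le
    by (intro order_trans[OF norm_blinfun_compose] mult_mono) auto
  then show ?thesis unfolding uemb_def using assms by (intro norm_direct_sum_op_le) auto
qed

section \<open>Compression, expectation and division by the shift\<close>

lemma entry_A_0: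
  assumes "T \<in> A" "\<And>x. entry \<xi> x 0 = 0"
  shows "entry (T \<xi>) x 0 = 0"
  using assms entry_A[of T x \<xi> 0] entry_A_outside[of T x \<xi> 0] by (cases "x \<in> topspace X") auto

text \<open>The compression acts on generators by composing the function with \<eta>. It is
  multiplicative because \<open>T\<close> preserves the vectors with vanishing zeroth coordinates,
  on which \<open>Ush o\<^sub>L Bsh\<close> is the identity.\<close>

lemma compress_in:
  assumes "T \<in> A"
  shows "Bsh o\<^sub>L T o\<^sub>L Ush \<in> A"
  using assms
proof (induction rule: A_induct)
  case (emb f)
  have "Bsh o\<^sub>L emb f o\<^sub>L Ush = emb (\<lambda>x. f (\<eta> x))"
    using emb by (intro op_eqI) (auto simp: entry_emb C0_eta entry_Ush entry_Bsh)
  then show ?case using emb by (simp add: emb_in C0_eta)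
next
  case (uemb f)
  have "Bsh o\<^sub>L uemb f o\<^sub>L Ush = uemb (\<lambda>x. f (\<eta> x))"
    using uemb by (intro op_eqI) (auto simp: entry_uemb C0_eta entry_Ush entry_Bsh split: nat.split)
  then show ?case using uemb by (simp add: uemb_in C0_eta)
next
  case zero
  have "Bsh o\<^sub>L 0 o\<^sub>L Ush = (0 :: 'a op)" by (rule blinfun_eqI) (simp add: blinfun.zero_right)
  then show ?case by (simp add: A_zero)
next
  case (add S T)
  have "Bsh o\<^sub>L (S + T) o\<^sub>L Ush = (Bsh o\<^sub>L S o\<^sub>L Ush) + (Bsh o\<^sub>L T o\<^sub>L Ush)"
    by (rule blinfun_eqI) (simp add: blinfun.add_left blinfun.add_right)
  then show ?case using add by (simp add: A_add)
next
  case (scale c T)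
  have "Bsh o\<^sub>L scaleC_op c T o\<^sub>L Ush = scaleC_op c (Bsh o\<^sub>L T o\<^sub>L Ush)"
    by (rule op_eqI) (simp add: l2_nth_scaleC_op entry_Bsh)
  then show ?case using scale by (simp add: A_scale)
next
  case (mult S T)
  have "Bsh o\<^sub>L (S o\<^sub>L T) o\<^sub>L Ush = (Bsh o\<^sub>L S o\<^sub>L Ush) o\<^sub>L (Bsh o\<^sub>L T o\<^sub>L Ush)"
  proof (rule blinfun_eqI)
    fix \<xi>
    have "Ush (Bsh (T (Ush \<xi>))) = T (Ush \<xi>)"
      by (rule Ush_Bsh, rule entry_A_0[OF \<open>T \<in> A\<close>]) (simp add: entry_Ush)
    then show "(Bsh o\<^sub>L (S o\<^sub>L T) o\<^sub>L Ush) \<xi>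
        = ((Bsh o\<^sub>L S o\<^sub>L Ush) o\<^sub>L (Bsh o\<^sub>L T o\<^sub>L Ush)) \<xi>" by simp
  qed
  then show ?case using mult by (simp add: A_mult)
next
  case (lim S T)
  have "(\<lambda>n. Bsh o\<^sub>L S n o\<^sub>L Ush) \<longlonglongrightarrow> (Bsh o\<^sub>L T o\<^sub>L Ush)"
    by (intro tendsto_blinfun_compose tendsto_const lim)
  then show ?case by (rule A_limit[rotated]) (rule lim.IH)
qed

text \<open>The expectation onto the diagonal copy of \<open>C0 X\<close>. Since only nonnegative
  powers of the shift occur, it is even multiplicative on the algebra.\<close>

definition E0 :: "'a op \<Rightarrow> 'a op" where "E0 T = emb (coef 0 T)"

lemma E0_in: "T \<in> A \<Longrightarrow> E0 T \<in> A"
  by (simp add: E0_def emb_in coef_C0)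

lemma E0_add: "S \<in> A \<Longrightarrow> T \<in> A \<Longrightarrow> E0 (S + T) = E0 S + E0 T"
  unfolding E0_def by (subst emb_add[symmetric]) (auto intro!: emb_cong simp: coef_C0 coef_add A_add)

lemma E0_diff: "S \<in> A \<Longrightarrow> T \<in> A \<Longrightarrow> E0 (S - T) = E0 S - E0 T"
  unfolding E0_def by (subst emb_diff[symmetric]) (auto intro!: emb_cong simp: coef_C0 coef_diff A_diff)

lemma E0_scale: "T \<in> A \<Longrightarrow> E0 (scaleC_op c T) = scaleC_op c (E0 T)"
  unfolding E0_def by (subst emb_scale[symmetric]) (auto intro!: emb_cong simp: coef_C0 coef_scaleC A_scale)

lemma E0_mult: "S \<in> A \<Longrightarrow> T \<in> A \<Longrightarrow> E0 (S o\<^sub>L T) = E0 S o\<^sub>L E0 T"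
  unfolding E0_def by (subst emb_mult[symmetric]) (auto intro!: emb_cong simp: coef_C0 coef_compose A_mult)

lemma norm_E0_le: "norm (E0 T) \<le> norm T"
  unfolding E0_def by (intro norm_emb_le norm_coef_le) auto

lemma entry_E0_remainder:
  assumes "T \<in> A"
  shows "entry ((T - E0 T) \<xi>) x 0 = 0"
  using entry_A[OF assms, of x \<xi> 0] entry_A_outside[OF assms, of x \<xi> 0] assms
  by (cases "x \<in> topspace X") (auto simp: E0_def entry_emb coef_C0 blinfun.diff_left entry_simps)

text \<open>
  Exact division by \<open>U\<close>: \<open>T = E0 T + U (quot T)\<close>. That \<open>quot T\<close> lies in the algebra again replaces
  density arguments for point derivations, which are not known to be continuous.
\<close>

definition quot :: "'a op \<Rightarrow> 'a op" where "quot T = Bsh o\<^sub>L (T - E0 T)"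

lemma Ush_quot: "T \<in> A \<Longrightarrow> Ush o\<^sub>L quot T = T - E0 T"
  by (rule blinfun_eqI) (simp add: quot_def Ush_Bsh entry_E0_remainder)

lemma quot_in:
  assumes "T \<in> A"
  shows "quot T \<in> A"
  using assms
proof (induction rule: A_induct)
  case (emb f)
  have "E0 (emb f) = emb f"
    unfolding E0_def using emb by (intro emb_cong) (auto simp: coef_C0 emb_in coef_emb)
  then have "quot (emb f) = 0"
    by (intro blinfun_eqI) (simp add: quot_def blinfun.zero_right)
  then show ?case by (simp add: A_zero)
next
  case (uemb f)
  have "E0 (uemb f) = emb (\<lambda>_. 0)"
    unfolding E0_def using uemb by (intro emb_cong) (auto simp: coef_C0 uemb_in coef_uemb)
  then have "quot (uemb f) = emb f"
    using uemb by (intro op_eqI)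
      (auto simp: quot_def entry_Bsh entry_uemb entry_emb C0_zero blinfun.diff_left entry_simps)
  then show ?case using uemb by (simp add: emb_in)
next
  case zero
  have "quot 0 = 0"
  proof -
    have "E0 0 = 0"
      by (rule op_eqI) (simp add: E0_def entry_emb coef_C0 A_zero coef_zero entry_simps)
    then show ?thesis by (intro blinfun_eqI) (simp add: quot_def blinfun.zero_right)
  qed
  then show ?case by (simp add: A_zero)
next
  case (add S T)
  have "quot (S + T) = quot S + quot T"
    using add by (intro blinfun_eqI) (simp add: quot_def E0_add blinfun.add_left blinfun.add_right
      blinfun.diff_left blinfun.diff_right)
  then show ?case using add by (simp add: A_add)
next
  case (scale c T)
  have "quot (scaleC_op c T) = scaleC_op c (quot T)"
    using scale by (intro op_eqI) (simp add: quot_def E0_scale l2_nth_scaleC_op entry_Bsh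
      blinfun.diff_left entry_simps right_diff_distrib)
  then show ?case using scale by (simp add: A_scale)
next
  case (mult S T)
  \<comment> \<open>Write \<open>S T - E0 S E0 T\<close> as
    \<open>(S - E0 S) E0 T + S (T - E0 T)\<close> and replace \<open>T - E0 T\<close> by
    \<open>Ush\<close> times \<open>quot T\<close>. The compression of \<open>S\<close> then appears
    in front of \<open>quot T\<close>.\<close>
  have "quot (S o\<^sub>L T) = (quot S o\<^sub>L E0 T) + ((Bsh o\<^sub>L S o\<^sub>L Ush) o\<^sub>L quot T)"
  proof -
    have "(Bsh o\<^sub>L S o\<^sub>L Ush) o\<^sub>L quot T = Bsh o\<^sub>L (S o\<^sub>L (T - E0 T))"
      using Ush_quot[OF \<open>T \<in> A\<close>] by (metis blinfun_compose_assoc)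
    then show ?thesis
      using mult by (intro blinfun_eqI) (simp add: quot_def E0_mult blinfun.add_left blinfun.add_right
      blinfun.diff_left blinfun.diff_right)
  qed
  then show ?case using mult by (simp add: A_add A_mult E0_in compress_in)
next
  case (lim S T)
  have "(\<lambda>n. E0 (S n)) \<longlonglongrightarrow> E0 T"
  proof (rule LIM_zero_cancel, rule Lim_null_comparison)
    show "\<forall>\<^sub>F n in sequentially. norm (E0 (S n) - E0 T) \<le> norm (S n - T)"
      using norm_E0_le[of "S n - T" for n] lim by (simp add: E0_diff)
    show "(\<lambda>n. norm (S n - T)) \<longlonglongrightarrow> 0"
      using \<open>S \<longlonglongrightarrow> T\<close> by (simp add: LIM_zero tendsto_norm_zero)
  qed
  then have "(\<lambda>n. quot (S n)) \<longlonglongrightarrow> quot T"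
    unfolding quot_def by (intro tendsto_blinfun_compose tendsto_const tendsto_diff lim)
  then show ?case by (rule A_limit[rotated]) (rule lim.IH)
qed

text \<open>Multiplying by \<open>emb f\<close> absorbs the bare shift into a generator, so that the
  remainder becomes a product of two members of the algebra.\<close>

lemma emb_decompose:
  assumes "T \<in> A" "f \<in> C0 X"
  shows "emb f o\<^sub>L T = (emb f o\<^sub>L E0 T) + (uemb (\<lambda>x. f (\<eta> x)) o\<^sub>L quot T)"
proof -
  have "uemb (\<lambda>x. f (\<eta> x)) o\<^sub>L quot T = emb f o\<^sub>L (T - E0 T)"
    using Ush_quot[OF assms(1)] emb_Ush[OF assms(2)] by (metis blinfun_compose_assoc)
  then show ?thesis
    by (intro blinfun_eqI) (simp add: blinfun.add_left blinfun.diff_left blinfun.diff_right)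
qed

section \<open>Point evaluations and point derivations\<close>

definition theta :: "'a \<Rightarrow> complex \<Rightarrow> 'a op \<Rightarrow> complex" where
  "theta x z T = (\<Sum>n. coef n T x * z ^ n)"

text \<open>The coefficient index runs one ahead of the exponent, as if one factor \<open>U\<close>
  had been divided out.\<close>

definition pder :: "'a \<Rightarrow> complex \<Rightarrow> 'a op \<Rightarrow> complex" where
  "pder x z T = (\<Sum>n. coef (Suc n) T x * z ^ n)"

lemma summable_coef: "norm z < 1 \<Longrightarrow> summable (\<lambda>n. norm (coef (k + n) T x * z ^ n))"
proof (rule summable_comparison_test[of _ "\<lambda>n. norm T * norm z ^ n"])
  show "\<exists>N. \<forall>n\<ge>N. norm (norm (coef (k + n) T x * z ^ n)) \<le> norm T * norm z ^ n"
    by (simp add: norm_mult norm_power mult_right_mono norm_coef_le)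
qed (auto intro: summable_mult summable_geometric)

lemma summable_theta: "norm z < 1 \<Longrightarrow> summable (\<lambda>n. norm (coef n T x * z ^ n))"
  using summable_coef[of z 0] by simp

lemma summable_pder: "norm z < 1 \<Longrightarrow> summable (\<lambda>n. norm (coef (Suc n) T x * z ^ n))"
  using summable_coef[of z 1] by simp

lemma theta_sums: "norm z < 1 \<Longrightarrow> (\<lambda>n. coef n T x * z ^ n) sums theta x z T"
  unfolding theta_def by (rule summable_sums[OF summable_norm_cancel[OF summable_theta]])

lemma pder_sums: "norm z < 1 \<Longrightarrow> (\<lambda>n. coef (Suc n) T x * z ^ n) sums pder x z T"
  unfolding pder_def by (rule summable_sums[OF summable_norm_cancel[OF summable_pder]])

lemma theta_holomorphic: "(\<lambda>z. theta x z T) holomorphic_on ball 0 1"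
  by (rule power_series_holomorphic[where a = "\<lambda>n. coef n T x"]) (simp add: theta_sums)

lemma theta_zero: "theta x 0 T = coef 0 T x"
  by (simp add: theta_def powser_zero)

lemma theta_add: "norm z < 1 \<Longrightarrow> theta x z (S + T) = theta x z S + theta x z T"
proof (rule sums_unique2)
  assume z: "norm z < 1"
  show "(\<lambda>n. coef n (S + T) x * z ^ n) sums theta x z (S + T)"
    by (rule theta_sums[OF z])
  show "(\<lambda>n. coef n (S + T) x * z ^ n) sums (theta x z S + theta x z T)"
    using sums_add[OF theta_sums[OF z] theta_sums[OF z]] by (simp add: coef_add distrib_right)
qed

lemma theta_scale: "norm z < 1 \<Longrightarrow> theta x z (scaleC_op c T) = c * theta x z T"
proof (rule sums_unique2)
  assume z: "norm z < 1"
  show "(\<lambda>n. coef n (scaleC_op c T) x * z ^ n) sums theta x z (scaleC_op c T)"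
    by (rule theta_sums[OF z])
  show "(\<lambda>n. coef n (scaleC_op c T) x * z ^ n) sums (c * theta x z T)"
    using sums_mult[OF theta_sums[OF z]] by (simp add: coef_scaleC mult.assoc)
qed

lemma pder_add: "norm z < 1 \<Longrightarrow> pder x z (S + T) = pder x z S + pder x z T"
proof (rule sums_unique2)
  assume z: "norm z < 1"
  show "(\<lambda>n. coef (Suc n) (S + T) x * z ^ n) sums pder x z (S + T)"
    by (rule pder_sums[OF z])
  show "(\<lambda>n. coef (Suc n) (S + T) x * z ^ n) sums (pder x z S + pder x z T)"
    using sums_add[OF pder_sums[OF z] pder_sums[OF z]] by (simp add: coef_add distrib_right)
qed

lemma iter_fixed: "\<eta> x = x \<Longrightarrow> (\<eta> ^^ n) x = x"
  by (induction n) auto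

text \<open>At a fixed point the iterate does nothing; for \<open>z = 0\<close> both sides vanish
  unless \<open>k = 0\<close>, where the iterate is the identity. This turns the twisted convolution
  into an ordinary Cauchy product.\<close>

lemma coef_iter_power:
  assumes "z = 0 \<or> \<eta> x = x" "m \<le> k"
  shows "coef (k - m) S ((\<eta> ^^ m) x) * c * z ^ k = (c * z ^ m) * (coef (k - m) S x * z ^ (k - m))"
proof -
  have p: "z ^ m * z ^ (k - m) = z ^ k" using assms(2) by (metis le_add_diff_inverse power_add)
  have "coef (k - m) S ((\<eta> ^^ m) x) * z ^ k = coef (k - m) S x * z ^ k"
    using assms by (cases "m = 0") (auto simp: iter_fixed power_0_left)
  then show ?thesis unfolding p[symmetric] by (simp add: ac_simps)
qed

lemma theta_mult:
  assumes "norm z < 1" "x \<in> topspace X" "z = 0 \<or> \<eta> x = x" "S \<in> A"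
  shows "theta x z (S o\<^sub>L T) = theta x z S * theta x z T"
proof -
  have "theta x z T * theta x z S
      = (\<Sum>k. \<Sum>m\<le>k. (coef m T x * z ^ m) * (coef (k - m) S x * z ^ (k - m)))"
    unfolding theta_def by (rule Cauchy_product) (auto intro: summable_theta assms)
  also have "\<dots> = theta x z (S o\<^sub>L T)"
    unfolding theta_def coef_compose[OF assms(4,2)] sum_distrib_right
    by (intro suminf_cong sum.cong refl coef_iter_power[OF assms(3), symmetric]) simp
  finally show ?thesis by (simp add: mult.commute)
qed

text \<open>The term \<open>m = 0\<close> of the convolution splits off and gives the first summand.
  In the other terms \<open>S\<close> is evaluated along the orbit of \<open>\<eta> x\<close>, so
  they form a Cauchy product if \<open>\<eta> x\<close> is fixed or \<open>z = 0\<close>.\<close>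

lemma pder_mult:
  assumes "norm z < 1" "x \<in> topspace X" "z = 0 \<or> \<eta> (\<eta> x) = \<eta> x" "S \<in> A"
  shows "pder x z (S o\<^sub>L T) = pder x z S * theta x 0 T + theta (\<eta> x) z S * pder x z T"
proof -
  have "pder x z T * theta (\<eta> x) z S
      = (\<Sum>k. \<Sum>m\<le>k. (coef (Suc m) T x * z ^ m) * (coef (k - m) S (\<eta> x) * z ^ (k - m)))"
    unfolding theta_def pder_def by (rule Cauchy_product) (auto intro: summable_theta summable_pder assms)
  moreover have "summable (\<lambda>k. \<Sum>m\<le>k. (coef (Suc m) T x * z ^ m) * (coef (k - m) S (\<eta> x) * z ^ (k - m)))"
    by (rule summable_Cauchy_product) (auto intro: summable_theta summable_pder assms)
  ultimately have 1: "(\<lambda>k. \<Sum>m\<le>k. (coef (Suc m) T x * z ^ m) * (coef (k - m) S (\<eta> x) * z ^ (k - m)))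
      sums (theta (\<eta> x) z S * pder x z T)"
    by (simp add: sums_iff mult.commute)
  have "coef (Suc k) (S o\<^sub>L T) x * z ^ k = coef (Suc k) S x * z ^ k * coef 0 T x
      + (\<Sum>m\<le>k. (coef (Suc m) T x * z ^ m) * (coef (k - m) S (\<eta> x) * z ^ (k - m)))" for k
  proof -
    have "coef (Suc k) (S o\<^sub>L T) x
        = coef (Suc k) S x * coef 0 T x + (\<Sum>m\<le>k. coef (k - m) S ((\<eta> ^^ m) (\<eta> x)) * coef (Suc m) T x)"
      unfolding coef_compose[OF assms(4,2)]
      by (subst sum.atMost_Suc_shift) (simp add: funpow_swap1)
    moreover have "(\<Sum>m\<le>k. coef (k - m) S ((\<eta> ^^ m) (\<eta> x)) * coef (Suc m) T x) * z ^ k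
       = (\<Sum>m\<le>k. (coef (Suc m) T x * z ^ m) * (coef (k - m) S (\<eta> x) * z ^ (k - m)))"
      unfolding sum_distrib_right by (intro sum.cong refl coef_iter_power assms) simp
    ultimately show ?thesis by (simp add: algebra_simps)
  qed
  then have "(\<lambda>k. coef (Suc k) (S o\<^sub>L T) x * z ^ k) sums
      (pder x z S * coef 0 T x + theta (\<eta> x) z S * pder x z T)"
    using sums_add[OF sums_mult2[OF pder_sums[OF assms(1), of S x], of "coef 0 T x"] 1] by simp
  then show ?thesis
    unfolding theta_zero by (rule sums_unique2[OF pder_sums[OF assms(1)]])
qed

lemma theta_emb: "f \<in> C0 X \<Longrightarrow> x \<in> topspace X \<Longrightarrow> theta x z (emb f) = f x"
  unfolding theta_def by (subst suminf_finite[of "{0}"]) (auto simp: coef_emb)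

lemma theta_uemb: "f \<in> C0 X \<Longrightarrow> x \<in> topspace X \<Longrightarrow> theta x z (uemb f) = z * f x"
  unfolding theta_def by (subst suminf_finite[of "{1}"]) (auto simp: coef_uemb)

lemma pder_uemb: "f \<in> C0 X \<Longrightarrow> x \<in> topspace X \<Longrightarrow> pder x z (uemb f) = f x"
  unfolding pder_def by (subst suminf_finite[of "{0}"]) (auto simp: coef_uemb)

end

section \<open>Characters\<close>

definition character :: "'a op set \<Rightarrow> ('a op \<Rightarrow> complex) \<Rightarrow> bool" where
  "character A \<phi> \<longleftrightarrow> (\<exists>T\<in>A. \<phi> T \<noteq> 0) \<and>
     (\<forall>S\<in>A. \<forall>T\<in>A. \<phi> (S + T) = \<phi> S + \<phi> T) \<and>
     (\<forall>c. \<forall>T\<in>A. \<phi> (scaleC_op c T) = c * \<phi> T) \<and>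
     (\<forall>S\<in>A. \<forall>T\<in>A. \<phi> (S o\<^sub>L T) = \<phi> S * \<phi> T)"

lemma character_add: "character A \<phi> \<Longrightarrow> S \<in> A \<Longrightarrow> T \<in> A \<Longrightarrow> \<phi> (S + T) = \<phi> S + \<phi> T"
  and character_scale: "character A \<phi> \<Longrightarrow> T \<in> A \<Longrightarrow> \<phi> (scaleC_op c T) = c * \<phi> T"
  and character_mult: "character A \<phi> \<Longrightarrow> S \<in> A \<Longrightarrow> T \<in> A \<Longrightarrow> \<phi> (S o\<^sub>L T) = \<phi> S * \<phi> T"
  by (simp_all add: character_def)

context dyn_system
begin

section \<open>Automatic continuity of characters\<close>

lemma character_diff:
  assumes "character A \<phi>" "S \<in> A" "T \<in> A"
  shows "\<phi> (S - T) = \<phi> S - \<phi> T"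
proof -
  have "\<phi> S = \<phi> ((S - T) + T)" by simp
  also have "\<dots> = \<phi> (S - T) + \<phi> T"
    by (rule character_add[OF assms(1) A_diff[OF assms(2,3)] assms(3)])
  finally show ?thesis by simp
qed

lemma character_zero: "character A \<phi> \<Longrightarrow> \<phi> 0 = 0"
  using character_diff[of \<phi> 0 0] A_zero by simp

text \<open>Otherwise a multiple \<open>a\<close> of \<open>T\<close> has norm below one and
  \<open>\<phi> a = 1\<close>. The contraction \<open>b \<mapsto> a + a b\<close> has a fixed point
  in the closed algebra, and applying \<phi> to it yields \<open>\<phi> b = 1 + \<phi> b\<close>.
  The quasi-inverse \<open>b\<close> stands in for an inverse of \<open>1 - a\<close>, as the
  algebra may have no unit.\<close>

lemma character_norm_le:
  assumes \<phi>: "character A \<phi>" and T: "T \<in> A"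
  shows "norm (\<phi> T) \<le> norm T"
proof (rule ccontr)
  assume *: "\<not> norm (\<phi> T) \<le> norm T"
  then have pos: "norm (\<phi> T) > 0" using order.strict_trans1[OF norm_ge_zero] by auto
  define a where "a = scaleC_op (1 / \<phi> T) T"
  have a: "a \<in> A" "\<phi> a = 1"
    using T \<phi> pos by (auto simp: a_def A_scale character_scale)
  have "norm a \<le> norm (1 / \<phi> T) * norm T" unfolding a_def by (rule norm_scaleC_op_le)
  also have "\<dots> < 1" using * pos by (simp add: norm_divide field_simps)
  finally have na: "norm a < 1" .
  have "\<exists>!b\<in>A. a + (a o\<^sub>L b) = b"
  proof (rule Banach_fix[of A "norm a" "\<lambda>b. a + (a o\<^sub>L b)"])
    show "complete A" using A_closed by (simp add: complete_eq_closed)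
    show "A \<noteq> {}" using a by blast
    show "(\<lambda>b. a + (a o\<^sub>L b)) ` A \<subseteq> A" using a by (auto intro: A_add A_mult)
    show "dist (a + (a o\<^sub>L b)) (a + (a o\<^sub>L c)) \<le> norm a * dist b c" for b c
    proof -
      have "(a + (a o\<^sub>L b)) - (a + (a o\<^sub>L c)) = a o\<^sub>L (b - c)"
        by (rule blinfun_eqI) (simp add: blinfun.diff_left blinfun.diff_right blinfun.add_left)
      then show ?thesis unfolding dist_norm by (simp add: norm_blinfun_compose)
    qed
  qed (use na in auto)
  then obtain b where b: "b \<in> A" "a + (a o\<^sub>L b) = b" by blast
  have "\<phi> b = \<phi> (a + (a o\<^sub>L b))" using b by simp
  also have "\<dots> = \<phi> a + \<phi> a * \<phi> b"
    by (simp add: character_add[OF \<phi>] character_mult[OF \<phi>] a b(1) A_mult)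
  finally have "\<phi> b = 1 + \<phi> b" unfolding a(2) mult_1 .
  then have "1 + \<phi> b = \<phi> b" by (rule sym)
  then show False by simp
qed

lemma character_tendsto:
  assumes \<phi>: "character A \<phi>" and S: "\<And>n::nat. S n \<in> A" and T: "T \<in> A" and ST: "S \<longlonglongrightarrow> T"
  shows "(\<lambda>n. \<phi> (S n)) \<longlonglongrightarrow> \<phi> T"
proof (rule LIM_zero_cancel, rule Lim_null_comparison)
  have "norm (\<phi> (S n) - \<phi> T) \<le> norm (S n - T)" for n
    using character_norm_le[OF \<phi> A_diff[OF S[of n] T]] unfolding character_diff[OF \<phi> S T] .
  then show "\<forall>\<^sub>F n in sequentially. norm (\<phi> (S n) - \<phi> T) \<le> norm (S n - T)" by simp
  show "(\<lambda>n. norm (S n - T)) \<longlonglongrightarrow> 0"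
    using ST by (simp add: LIM_zero tendsto_norm_zero)
qed

lemma character_eqI:
  assumes \<phi>: "character A \<phi>" and \<psi>: "character A \<psi>"
    and emb: "\<And>f. f \<in> C0 X \<Longrightarrow> \<phi> (emb f) = \<psi> (emb f)"
    and uemb: "\<And>f. f \<in> C0 X \<Longrightarrow> \<phi> (uemb f) = \<psi> (uemb f)"
    and T: "T \<in> A"
  shows "\<phi> T = \<psi> T"
  using T
proof (induction rule: A_induct)
  case (lim S T)
  show ?case
    using character_tendsto[OF \<phi> lim(1)] character_tendsto[OF \<psi> lim(1)] lim
      LIMSEQ_unique[of "\<lambda>n. \<phi> (S n)" "\<phi> T" "\<psi> T"] by simp
qed (simp_all add: emb uemb character_zero[OF \<phi>] character_add[OF \<phi>] character_scale[OF \<phi>]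
  character_mult[OF \<phi>] character_zero[OF \<psi>] character_add[OF \<psi>] character_scale[OF \<psi>]
  character_mult[OF \<psi>])

text \<open>By \<open>C0_factor\<close> every \<open>uemb f\<close> is a product with a right factor
  \<open>emb h\<close>. A character vanishing on the diagonal would thus vanish on all generators
  and, by continuity, everywhere.\<close>

lemma character_emb_nonzero:
  assumes \<phi>: "character A \<phi>"
  shows "\<exists>f\<in>C0 X. \<phi> (emb f) \<noteq> 0"
proof (rule ccontr)
  assume "\<not> ?thesis"
  then have 0: "\<phi> (emb f) = 0" if "f \<in> C0 X" for f using that by blast
  have "\<phi> T = 0" if "T \<in> A" for T
    using that
  proof (induction rule: A_induct)
    case (uemb f)
    obtain g h where gh: "g \<in> C0 X" "h \<in> C0 X" "\<And>x. f x = g x * h x"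
      using C0_factor[OF uemb] by metis
    have "f = (\<lambda>x. g x * h x)" using gh(3) by blast
    then have "uemb f = uemb g o\<^sub>L emb h" using gh by (simp add: uemb_emb)
    then show ?case using gh 0 by (simp add: character_mult[OF \<phi>] uemb_in emb_in)
  next
    case (lim S T)
    then show ?case
      using character_tendsto[OF \<phi> lim(1)] LIMSEQ_unique[of "\<lambda>n. \<phi> (S n)" "\<phi> T" 0] by simp
  qed (simp_all add: 0 character_zero[OF \<phi>] character_add[OF \<phi>] character_scale[OF \<phi>]
    character_mult[OF \<phi>])
  then show False using \<phi> unfolding character_def by blast
qed

section \<open>The point underlying a character\<close>

definition over :: "('a op \<Rightarrow> complex) \<Rightarrow> 'a \<Rightarrow> bool" where
  "over \<phi> x \<longleftrightarrow> x \<in> topspace X \<and> (\<forall>f\<in>C0 X. \<phi> (emb f) = f x)"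

lemma C0_peak:
  assumes "x \<in> topspace X"
  obtains f where "f \<in> C0 X" "f x = 1" "\<And>y. y \<in> topspace X \<Longrightarrow> norm (f y) \<le> 1"
  by (rule C0_separation[OF lc haus openin_topspace assms]) (rule that)

lemma C0_separate_points:
  assumes "x \<in> topspace X" "y \<in> topspace X" "x \<noteq> y"
  obtains f where "f \<in> C0 X" "f x = 1" "f y = 0" "\<And>y. f y \<in> \<real>"
proof -
  have "closedin X {y}" by (rule closedin_Hausdorff_singleton[OF haus assms(2)])
  then have U: "openin X (topspace X - {y})" by (rule openin_diff[OF openin_topspace])
  have xU: "x \<in> topspace X - {y}" using assms by blast
  show ?thesis
  proof (rule C0_separation[OF lc haus U xU])
    fix f assume f: "f \<in> C0 X" "f x = 1" "\<And>y. f y \<in> \<real>"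
      and 0: "\<And>z. z \<in> topspace X - (topspace X - {y}) \<Longrightarrow> f z = 0"
    have "f y = 0" by (rule 0) (use assms in blast)
    then show thesis by (rule that[OF f(1,2) _ f(3)])
  qed
qed

lemma character_emb_sum:
  assumes \<phi>: "character A \<phi>" and "finite J" "\<And>i. i \<in> J \<Longrightarrow> f i \<in> C0 X"
  shows "\<phi> (emb (\<lambda>x. \<Sum>i\<in>J. f i x)) = (\<Sum>i\<in>J. \<phi> (emb (f i)))"
  using assms(2,3)
proof (induction J rule: finite_induct)
  case empty
  have "emb (\<lambda>_. 0) = 0" by (rule op_eqI) (simp add: entry_emb C0_zero entry_simps)
  then show ?case using character_zero[OF \<phi>] by simp
next
  case (insert i J)
  then show ?case
    by (simp add: emb_add C0_sum character_add[OF \<phi>] emb_in)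
qed

text \<open>
  If the functions killed by \<open>\<phi>\<close> had no common zero, then finitely many of them would combine to
  \<open>F \<ge> 0\<close> in the kernel, positive on a compact set off which \<open>g\<close> is small, where \<open>\<phi> g = 1\<close>.
  With \<open>G = F + \<bar>1 - g\<bar>\<^sup>2\<close> this gives \<open>g = F (g / G) + (1 - g) (cnj (1 - g) g / G)\<close>,
  and \<open>\<phi>\<close> kills both summands.
\<close>

lemma character_over:
  assumes \<phi>: "character A \<phi>"
  obtains x where "over \<phi> x"
proof -
  obtain g0 where g0: "g0 \<in> C0 X" "\<phi> (emb g0) \<noteq> 0" using character_emb_nonzero[OF \<phi>] by blast
  define g where "g = (\<lambda>x. (1 / \<phi> (emb g0)) * g0 x)"
  have g: "g \<in> C0 X" unfolding g_def by (rule C0_cmult[OF g0(1)])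
  have \<phi>g: "\<phi> (emb g) = 1"
    unfolding g_def emb_scale[OF g0(1)] using g0 by (simp add: character_scale[OF \<phi>] emb_in)
  have "\<exists>x\<in>topspace X. \<forall>f\<in>C0 X. \<phi> (emb f) = 0 \<longrightarrow> f x = 0"
  proof (rule ccontr)
    assume "\<not> ?thesis"
    then have "\<forall>x\<in>topspace X. \<exists>f. f \<in> C0 X \<and> \<phi> (emb f) = 0 \<and> f x \<noteq> 0" by blast
    then obtain k where k: "\<And>x. x \<in> topspace X \<Longrightarrow> k x \<in> C0 X"
        "\<And>x. x \<in> topspace X \<Longrightarrow> \<phi> (emb (k x)) = 0" "\<And>x. x \<in> topspace X \<Longrightarrow> k x x \<noteq> 0"
      by metis
    obtain K where K: "compactin X K" "\<And>x. x \<in> topspace X - K \<Longrightarrow> norm (g x) < 1/2"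
      using C0_vanish[OF g, of "1/2"] by auto
    have KX: "K \<subseteq> topspace X" using K(1) compactin_subset_topspace by blast
    define U where "U = (\<lambda>x. {y \<in> topspace X. k x y \<noteq> 0})"
    have Uo: "openin X (U x)" if "x \<in> topspace X" for x
    proof -
      have "openin X {y \<in> topspace X. k x y \<in> - {0}}"
        using openin_continuous_map_preimage[OF C0_cont[OF k(1)[OF that]], of "- {0}"]
        by (simp add: open_Compl)
      then show ?thesis by (simp add: U_def)
    qed
    have "\<exists>\<F>. finite \<F> \<and> \<F> \<subseteq> U ` K \<and> K \<subseteq> \<Union>\<F>"
    proof (rule compactinD[OF K(1)])
      show "openin X V" if "V \<in> U ` K" for V using that Uo KX by blast
      show "K \<subseteq> \<Union>(U ` K)" using KX k(3) by (auto simp: U_def)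
    qed
    then obtain J where J: "finite J" "J \<subseteq> K" "K \<subseteq> (\<Union>x\<in>J. U x)"
      by (metis finite_subset_image)
    define F where "F = (\<lambda>y. \<Sum>x\<in>J. cnj (k x y) * k x y)"
    have kJ: "x \<in> J \<Longrightarrow> k x \<in> C0 X" for x using J KX k(1) by blast
    have kkJ: "x \<in> J \<Longrightarrow> (\<lambda>y. cnj (k x y) * k x y) \<in> C0 X" for x
      by (intro C0_mult C0_cnj kJ)
    have F: "F \<in> C0 X" unfolding F_def by (rule C0_sum[OF kkJ])
    have \<phi>F: "\<phi> (emb F) = 0"
    proof -
      have "\<phi> (emb (\<lambda>y. cnj (k x y) * k x y)) = 0" if "x \<in> J" for x
        using that J KX k(2) by (subst emb_mult) (auto simp: kJ C0_cnj character_mult[OF \<phi>] emb_in)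
      then show ?thesis unfolding F_def by (simp add: character_emb_sum[OF \<phi> J(1) kkJ])
    qed
    \<comment> \<open>This is the \<open>G\<close> of the remark above as a real number. It is at
      least 1/4 off \<open>K\<close>, where \<open>g\<close> is below 1/2 in modulus, and positive
      on \<open>K\<close>, where some \<open>k x\<close> does not vanish.\<close>
    define P where "P = (\<lambda>y. (\<Sum>x\<in>J. (norm (k x y))\<^sup>2) + (norm (1 - g y))\<^sup>2)"
    have G: "F y + (1 - g y) * cnj (1 - g y) = complex_of_real (P y)" for y
      unfolding F_def P_def of_real_add of_real_sum complex_norm_square by (simp only: mult.commute)
    have P0: "P y \<ge> (norm (1 - g y))\<^sup>2" for y unfolding P_def by (simp add: sum_nonneg)
    have Poff: "P y \<ge> 1/4" if "y \<in> topspace X - K" for y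
    proof -
      have "norm (1 - g y) \<ge> 1/2" using K(2)[OF that] norm_triangle_ineq2[of 1 "g y"] by simp
      then have "(norm (1 - g y))\<^sup>2 \<ge> (1/2)\<^sup>2" by (rule power_mono) simp
      then show ?thesis using P0[of y] by (simp add: power2_eq_square)
    qed
    have Ppos: "P y > 0" if "y \<in> topspace X" for y
    proof (cases "y \<in> K")
      case True
      then obtain x where "x \<in> J" "k x y \<noteq> 0" using J(3) by (auto simp: U_def)
      then have "(\<Sum>x\<in>J. (norm (k x y))\<^sup>2) > 0" using J(1) by (intro sum_pos2) auto
      then show ?thesis unfolding P_def by (simp add: add_pos_nonneg)
    next
      case False
      then show ?thesis using Poff[of y] that by auto
    qed
    have cg: "continuous_map X euclidean g" by (rule C0_cont[OF g])
    have ccnj: "continuous_map X euclidean (\<lambda>y. cnj (1 - g y))"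
      using cg by (simp add: continuous_map_atin tendsto_cnj tendsto_diff del: complex_cnj_diff)
    have cP: "continuous_map X euclidean (\<lambda>y. complex_of_real (P y))"
      unfolding G[symmetric] using ccnj cg C0_cont[OF F]
      by (simp add: continuous_map_atin tendsto_add tendsto_mult tendsto_diff del: complex_cnj_diff)
    define u where "u = (\<lambda>y. g y / complex_of_real (P y))"
    have u: "u \<in> C0 X"
    proof -
      have "continuous_map X euclidean u"
        using cg cP Ppos unfolding u_def continuous_map_atin
        by (auto intro!: tendsto_divide simp: less_imp_neq[symmetric])
      moreover have "\<exists>L. compactin X L \<and> (\<forall>x\<in>topspace X - L. norm (u x) < e)" if "e > 0" for e
      proof -
        obtain L where L: "compactin X L" "\<And>x. x \<in> topspace X - L \<Longrightarrow> norm (g x) < e / 4"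
          using C0_vanish[OF g, of "e/4"] \<open>e > 0\<close> by auto
        have "norm (u x) < e" if "x \<in> topspace X - (K \<union> L)" for x
        proof -
          have "norm (g x) < e / 4" "P x \<ge> 1/4" using L(2) Poff that by auto
          moreover have "e * P x \<ge> e * (1/4)"
            using \<open>e > 0\<close> \<open>P x \<ge> 1/4\<close> by (intro mult_left_mono) auto
          ultimately show ?thesis by (simp add: u_def norm_divide field_simps)
        qed
        then show ?thesis using compactin_Un[OF K(1) L(1)] by blast
      qed
      ultimately show ?thesis by (simp add: C0_def)
    qed
    define v where "v = (\<lambda>y. cnj (1 - g y) * u y)"
    have v: "v \<in> C0 X"
    proof -
      obtain c where c: "\<And>x. x \<in> topspace X \<Longrightarrow> norm (g x) \<le> c" using bounded_C0[OF g] by metis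
      have "norm (cnj (1 - g y)) \<le> 1 + c" if "y \<in> topspace X" for y
        using c[OF that] norm_triangle_ineq4[of 1 "g y"] unfolding complex_mod_cnj by simp
      then show ?thesis unfolding v_def by (rule C0_bounded_mult[OF u ccnj])
    qed
    \<comment> \<open>The summand \<open>(1 - g) v\<close> is written as \<open>v - g v\<close> to
      stay inside \<open>C0 X\<close>; since \<open>\<phi>\<close> is 1 on \<open>g\<close>, the two
      parts cancel under \<phi>.\<close>
    have eq: "(F y * u y + v y) - g y * v y = g y" if "y \<in> topspace X" for y
    proof -
      have "(F y * u y + v y) - g y * v y = (F y + (1 - g y) * cnj (1 - g y)) * u y"
        by (simp add: v_def algebra_simps del: complex_cnj_diff)
      also have "\<dots> = g y" unfolding G u_def using Ppos[OF that] by simp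
      finally show ?thesis .
    qed
    have "emb g = (emb F o\<^sub>L emb u) + emb v - (emb g o\<^sub>L emb v)"
      using F u v g eq
      by (subst emb_cong[of g "\<lambda>y. (F y * u y + v y) - g y * v y"])
         (simp_all add: emb_diff emb_add emb_mult C0_mult C0_add)
    then have "\<phi> (emb g) = \<phi> ((emb F o\<^sub>L emb u) + emb v - (emb g o\<^sub>L emb v))"
      by (rule arg_cong)
    also have "\<dots> = \<phi> (emb F) * \<phi> (emb u) + \<phi> (emb v) - \<phi> (emb g) * \<phi> (emb v)"
      using F u v g by (simp add: character_diff[OF \<phi>] character_add[OF \<phi>] character_mult[OF \<phi>]
        emb_in A_mult A_add)
    finally show False using \<phi>g \<phi>F by simp
  qed
  then obtain x where x: "x \<in> topspace X" "\<And>f. f \<in> C0 X \<Longrightarrow> \<phi> (emb f) = 0 \<Longrightarrow> f x = 0" by blast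
  \<comment> \<open>The function \<open>f - \<phi>(f) g\<close> lies in the kernel, hence vanishes
    at \<open>x\<close>. It remains to see \<open>g x = 1\<close>: a peak function shows that
    \<open>g x\<close> is nonzero, and the choice \<open>f = g^2\<close> shows that it is
    idempotent.\<close>
  have fx: "f x = \<phi> (emb f) * g x" if f: "f \<in> C0 X" for f
  proof -
    have "\<phi> (emb (\<lambda>y. f y - \<phi> (emb f) * g y)) = 0"
      using f g \<phi>g by (simp add: emb_diff C0_cmult emb_scale character_diff[OF \<phi>] character_scale[OF \<phi>]
        emb_in A_scale)
    then have "f x - \<phi> (emb f) * g x = 0"
      using x(2)[of "\<lambda>y. f y - \<phi> (emb f) * g y"] f g by (simp add: C0_diff C0_cmult)
    then show ?thesis by simp
  qed
  obtain e where "e \<in> C0 X" "e x = 1" using C0_peak[OF x(1)] by metis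
  then have "g x \<noteq> 0" using fx[of e] by auto
  moreover have "g x * g x = g x"
    using fx[of "\<lambda>y. g y * g y"] g \<phi>g by (simp add: C0_mult emb_mult character_mult[OF \<phi>] emb_in)
  ultimately have "g x = 1" by simp
  then show ?thesis using fx x(1) by (intro that[of x]) (simp add: over_def)
qed

text \<open>Real functions already separate points. Agreement on them is what the argument with
  discs delivers.\<close>

lemma over_unique:
  assumes "over \<phi> x" "over \<psi> y" "\<And>f. f \<in> C0 X \<Longrightarrow> (\<And>x. f x \<in> \<real>) \<Longrightarrow> \<phi> (emb f) = \<psi> (emb f)"
  shows "x = y"
proof (rule ccontr)
  assume "x \<noteq> y"
  moreover have xy: "x \<in> topspace X" "y \<in> topspace X" using assms by (auto simp: over_def)
  ultimately obtain f where f: "f \<in> C0 X" "f x = 1" "f y = 0" "\<And>y. f y \<in> \<real>"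
    using C0_separate_points by metis
  then show False using assms unfolding over_def by (metis zero_neq_one)
qed

text \<open>Functions commute, so \<open>uemb g\<close> times \<open>emb e\<close> equals
  \<open>uemb e\<close> times \<open>emb g\<close>; with \<open>e x = 1\<close> this gives the
  formula with \<open>z = \<phi> (uemb e)\<close>. The relation
  \<open>f U = U (f \<circ> \<eta>)\<close> then gives \<open>f(x) z = z f(\<eta> x)\<close>, which
  forces \<open>z = 0\<close> when \<open>f\<close> separates \<open>x\<close> from
  \<open>\<eta> x\<close>.\<close>

lemma character_parameter:
  assumes \<phi>: "character A \<phi>" and x: "over \<phi> x"
  obtains z where "norm z \<le> 1" "\<And>g. g \<in> C0 X \<Longrightarrow> \<phi> (uemb g) = z * g x" "z = 0 \<or> \<eta> x = x"
proof -
  have xX: "x \<in> topspace X" and ev: "\<And>f. f \<in> C0 X \<Longrightarrow> \<phi> (emb f) = f x"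
    using x by (auto simp: over_def)
  obtain e where e: "e \<in> C0 X" "e x = 1" "\<And>y. y \<in> topspace X \<Longrightarrow> norm (e y) \<le> 1"
    using C0_peak[OF xX] by metis
  define z where "z = \<phi> (uemb e)"
  have z: "\<phi> (uemb g) = z * g x" if g: "g \<in> C0 X" for g
  proof -
    have "uemb g o\<^sub>L emb e = uemb e o\<^sub>L emb g"
      using g e by (simp add: uemb_emb mult.commute)
    then have "\<phi> (uemb g o\<^sub>L emb e) = \<phi> (uemb e o\<^sub>L emb g)" by simp
    then show ?thesis
      using g e ev by (simp add: character_mult[OF \<phi>] uemb_in emb_in z_def)
  qed
  have "norm z \<le> norm (uemb e)" unfolding z_def by (rule character_norm_le[OF \<phi> uemb_in[OF e(1)]])
  also have "\<dots> \<le> 1" by (rule norm_uemb_le) (use e in auto)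
  finally have "norm z \<le> 1" .
  moreover have "z = 0" if "\<eta> x \<noteq> x"
  proof -
    obtain f where f: "f \<in> C0 X" "f x = 1" "f (\<eta> x) = 0"
      using C0_separate_points[OF xX eta_in[OF xX]] \<open>\<eta> x \<noteq> x\<close> by metis
    have "f x * z = \<phi> (emb f o\<^sub>L uemb e)"
      using f e ev by (simp add: character_mult[OF \<phi>] uemb_in emb_in z_def)
    also have "\<dots> = z * (f (\<eta> x) * e x)"
      using f e by (simp add: emb_uemb z C0_mult C0_eta)
    finally show ?thesis using f by simp
  qed
  ultimately show ?thesis using that z by blast
qed

section \<open>Disc characters and their radial limits\<close>

lemma theta_character:
  assumes "norm z < 1" "x \<in> topspace X" "z = 0 \<or> \<eta> x = x"
  shows "character A (theta x z)"
proof -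
  obtain e where "e \<in> C0 X" "e x = 1" using C0_peak[OF assms(2)] by metis
  then have "\<exists>T\<in>A. theta x z T \<noteq> 0"
    using assms by (intro bexI[of _ "emb e"]) (auto simp: theta_emb emb_in)
  then show ?thesis
    unfolding character_def using theta_add theta_scale theta_mult assms by blast
qed

lemma theta_over: "x \<in> topspace X \<Longrightarrow> over (theta x z) x"
  by (simp add: over_def theta_emb)

lemma character_eq_theta:
  assumes "character A \<phi>" "over \<phi> x" "norm z < 1" "\<And>g. g \<in> C0 X \<Longrightarrow> \<phi> (uemb g) = z * g x"
    "z = 0 \<or> \<eta> x = x" "T \<in> A"
  shows "\<phi> T = theta x z T"
proof (rule character_eqI[OF assms(1) theta_character])
qed (use assms in \<open>auto simp: over_def theta_emb theta_uemb\<close>)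

lemma character_nonfixed:
  assumes "character A \<phi>" "over \<phi> x" "\<eta> x \<noteq> x" "T \<in> A"
  shows "\<phi> T = theta x 0 T"
proof -
  obtain z where "\<And>g. g \<in> C0 X \<Longrightarrow> \<phi> (uemb g) = z * g x" "z = 0 \<or> \<eta> x = x"
    using character_parameter[OF assms(1,2)] by metis
  then show ?thesis using assms by (intro character_eq_theta) auto
qed

text \<open>On the boundary circle the series of \<open>theta\<close> need not converge, so boundary
  characters are reached radially. Convergence passes from generators to sums and products, and to
  norm limits by an \<open>e / 3\<close> argument, since all the characters involved are
  contractive.\<close>

lemma theta_tendsto_character:
  assumes \<phi>: "character A \<phi>" and x: "over \<phi> x" and z: "norm z \<le> 1"
    and u: "\<And>g. g \<in> C0 X \<Longrightarrow> \<phi> (uemb g) = z * g x" and fx: "z = 0 \<or> \<eta> x = x" and T: "T \<in> A"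
  shows "((\<lambda>r. theta x (of_real r * z) T) \<longlongrightarrow> \<phi> T) (at_left 1)"
proof -
  have xX: "x \<in> topspace X" using x by (simp add: over_def)
  have lt: "norm (of_real r * z) < 1" if "0 < r" "r < 1" for r :: real
  proof -
    have "r * norm z \<le> r * 1" using that z by (intro mult_left_mono) auto
    then have "r * norm z < 1" using that by linarith
    then show ?thesis using that by (simp add: norm_mult)
  qed
  have ch: "character A (theta x (of_real r * z))" if "0 < r" "r < 1" for r :: real
    using lt[OF that] xX fx by (intro theta_character) auto
  have ev: "\<forall>\<^sub>F r in at_left (1::real). Q r" if "\<And>r. 0 < r \<Longrightarrow> r < 1 \<Longrightarrow> Q r" for Q
    using that eventually_at_left[of 0 "1::real" Q] by (auto intro!: exI[of _ 0])
  show ?thesis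
    using T
  proof (induction rule: A_induct)
    case (emb f)
    then show ?case using x xX by (simp add: theta_emb over_def)
  next
    case (uemb f)
    have "((\<lambda>r. of_real r * z * f x) \<longlongrightarrow> of_real 1 * z * f x) (at_left (1::real))"
      by (intro tendsto_intros)
    then show ?case using uemb xX u by (simp add: theta_uemb)
  next
    case zero
    have "\<forall>\<^sub>F r in at_left (1::real). 0 = theta x (of_real r * z) 0"
      by (rule ev) (simp add: character_zero[OF ch])
    then show ?case unfolding character_zero[OF \<phi>] by (rule Lim_transform_eventually[OF tendsto_const])
  next
    case (add S T)
    have "\<forall>\<^sub>F r in at_left (1::real). theta x (of_real r * z) S + theta x (of_real r * z) T
        = theta x (of_real r * z) (S + T)"
      by (rule ev) (simp add: theta_add lt)
    then show ?case
      using Lim_transform_eventually[OF tendsto_add[OF add.IH]] add.hyps by (simp add: character_add[OF \<phi>])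
  next
    case (scale c T)
    have "\<forall>\<^sub>F r in at_left (1::real). c * theta x (of_real r * z) T
        = theta x (of_real r * z) (scaleC_op c T)"
      by (rule ev) (simp add: theta_scale lt)
    then show ?case
      using Lim_transform_eventually[OF tendsto_mult_left[OF scale.IH]] scale.hyps
      by (simp add: character_scale[OF \<phi>])
  next
    case (mult S T)
    have "\<forall>\<^sub>F r in at_left (1::real). theta x (of_real r * z) S * theta x (of_real r * z) T
        = theta x (of_real r * z) (S o\<^sub>L T)"
      by (rule ev) (simp add: character_mult[OF ch] mult.hyps)
    then show ?case
      using Lim_transform_eventually[OF tendsto_mult[OF mult.IH]] mult.hyps
      by (simp add: character_mult[OF \<phi>])
  next
    case (lim S T)
    show ?case
    proof (rule tendstoI)
      fix e :: real assume "e > 0"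
      then obtain n where n: "norm (S n - T) < e / 3"
        using \<open>S \<longlonglongrightarrow> T\<close> unfolding LIMSEQ_iff by (metis order_refl zero_less_divide_iff zero_less_numeral)
      have Sn: "S n \<in> A" and tn: "((\<lambda>r. theta x (of_real r * z) (S n)) \<longlongrightarrow> \<phi> (S n)) (at_left 1)"
        using lim by auto
      have \<phi>n: "norm (\<phi> (S n) - \<phi> T) < e / 3"
        using character_norm_le[OF \<phi> A_diff[OF Sn \<open>T \<in> A\<close>]] n
        by (simp add: character_diff[OF \<phi> Sn \<open>T \<in> A\<close>])
      have tn': "norm (theta x (of_real r * z) (S n) - theta x (of_real r * z) T) < e / 3"
        if r: "0 < r" "r < 1" for r :: real
        using character_norm_le[OF ch[OF r] A_diff[OF Sn \<open>T \<in> A\<close>]] n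
        by (simp add: character_diff[OF ch[OF r] Sn \<open>T \<in> A\<close>])
      have "\<forall>\<^sub>F r in at_left 1. dist (theta x (of_real r * z) (S n)) (\<phi> (S n)) < e / 3"
        by (rule tendstoD[OF tn]) (use \<open>e > 0\<close> in simp)
      moreover have "\<forall>\<^sub>F r in at_left (1::real).
          norm (theta x (of_real r * z) (S n) - theta x (of_real r * z) T) < e / 3"
        by (rule ev[OF tn'])
      ultimately show "\<forall>\<^sub>F r in at_left 1. dist (theta x (of_real r * z) T) (\<phi> T) < e"
      proof eventually_elim
        case (elim r)
        have "theta x (of_real r * z) T - \<phi> T
            = (theta x (of_real r * z) (S n) - \<phi> (S n)) + (\<phi> (S n) - \<phi> T)
              - (theta x (of_real r * z) (S n) - theta x (of_real r * z) T)" by simp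
        also have "norm \<dots> < e"
          using elim \<phi>n unfolding dist_norm
          by (intro order.strict_trans1[OF norm_triangle_ineq4]
              order.strict_trans1[OF add_right_mono[OF norm_triangle_ineq]]) linarith
        finally show ?case by (simp add: dist_norm)
      qed
    qed
  qed
qed

section \<open>Inner point derivations\<close>

text \<open>After subtraction of an inner part, \<open>D'\<close> is zero on every
  \<open>emb g\<close>, as these commute with \<open>e\<close>. It is zero on \<open>uemb g\<close>
  because \<open>h (\<eta> x) = 0\<close> while \<open>h y = 1\<close>. Exact division then reaches
  all of the algebra without any continuity of \<open>D\<close>.\<close>

lemma point_derivation_inner:
  fixes D :: "'a op \<Rightarrow> complex"
  assumes xy: "x \<in> topspace X" "y \<in> topspace X" "x \<noteq> y" "\<eta> x \<noteq> y"
    and add: "\<And>S T. S \<in> A \<Longrightarrow> T \<in> A \<Longrightarrow> D (S + T) = D S + D T"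
    and mult: "\<And>S T. S \<in> A \<Longrightarrow> T \<in> A \<Longrightarrow> D (S o\<^sub>L T) = D S * theta x 0 T + theta y 0 S * D T"
  shows "\<exists>c. \<forall>T\<in>A. D T = c * (theta x 0 T - theta y 0 T)"
proof -
  have chx: "character A (theta x 0)" and chy: "character A (theta y 0)"
    using xy by (auto intro: theta_character)
  obtain e where e: "e \<in> C0 X" "e x = 1" "e y = 0" using C0_separate_points[OF xy(1-3)] by metis
  obtain e' where e': "e' \<in> C0 X" "e' y = 1" using C0_peak[OF xy(2)] by metis
  obtain h where h: "h \<in> C0 X" "h y = 1" "h (\<eta> x) = 0"
    using C0_separate_points[OF xy(2) eta_in[OF xy(1)]] xy(4) by metis
  \<comment> \<open>The two characters differ by 1 on \<open>emb e\<close>, so this constant makes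
    \<open>D'\<close> vanish there.\<close>
  define c where "c = D (emb e)"
  define D' where "D' = (\<lambda>T. D T - c * (theta x 0 T - theta y 0 T))"
  have add': "D' (S + T) = D' S + D' T" if "S \<in> A" "T \<in> A" for S T
    using that by (simp add: D'_def add character_add[OF chx] character_add[OF chy] algebra_simps)
  have mult': "D' (S o\<^sub>L T) = D' S * theta x 0 T + theta y 0 S * D' T" if "S \<in> A" "T \<in> A" for S T
    using that by (simp add: D'_def mult character_mult[OF chx] character_mult[OF chy] algebra_simps)
  have D'e: "D' (emb e) = 0" using e xy by (simp add: D'_def c_def theta_emb)
  have D'emb: "D' (emb g) = 0" if g: "g \<in> C0 X" for g
  proof -
    have "emb g o\<^sub>L emb e = emb e o\<^sub>L emb g"
      using g e by (simp add: emb_mult[symmetric] mult.commute)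
    then have "D' (emb g o\<^sub>L emb e) = D' (emb e o\<^sub>L emb g)" by simp
    then show ?thesis using g e xy D'e by (simp add: mult' emb_in theta_emb)
  qed
  have D'uemb: "D' (uemb g) = 0" if g: "g \<in> C0 X" for g
  proof -
    have "emb h o\<^sub>L uemb g = uemb g o\<^sub>L emb (\<lambda>x. h (\<eta> x))"
      using g h by (simp add: emb_uemb uemb_emb C0_eta mult.commute)
    then have "D' (emb h o\<^sub>L uemb g) = D' (uemb g o\<^sub>L emb (\<lambda>x. h (\<eta> x)))" by simp
    then show ?thesis
      using g h xy by (simp add: mult' emb_in uemb_in C0_eta theta_emb D'emb)
  qed
  have "D' T = 0" if T: "T \<in> A" for T
  proof -
    \<comment> \<open>The function \<open>e'\<close> acts as a unit at \<open>y\<close>. In the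
      decomposition, the unknown value of \<open>D'\<close> at \<open>quot T\<close> is multiplied
      by the value of \<open>theta y 0\<close> at a shifted generator, which is zero.\<close>
    have "D' T = D' (emb e' o\<^sub>L T)"
      using T e' xy by (simp add: mult' emb_in theta_emb D'emb)
    also have "\<dots> = D' (emb e' o\<^sub>L E0 T) + D' (uemb (\<lambda>x. e' (\<eta> x)) o\<^sub>L quot T)"
      unfolding emb_decompose[OF T e'(1)]
      using T e' by (intro add') (auto intro!: A_mult emb_in uemb_in C0_eta E0_in quot_in)
    also have "D' (emb e' o\<^sub>L E0 T) = 0"
      using T e' xy by (simp add: mult' emb_in E0_def coef_C0 D'emb)
    also have "D' (uemb (\<lambda>x. e' (\<eta> x)) o\<^sub>L quot T) = 0"
      using T e' xy by (simp add: mult' uemb_in C0_eta quot_in D'uemb theta_uemb)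
    finally show ?thesis by simp
  qed
  then show ?thesis by (intro exI[of _ c]) (simp add: D'_def)
qed

end

section \<open>Algebra isomorphisms\<close>

text \<open>By the open mapping theorem a nonconstant function would have a nonreal value, just
  above \<open>f a\<close>.\<close>

lemma real_valued_holomorphic_constant:
  assumes f: "f holomorphic_on S" and S: "open S" "connected S" and r: "\<And>w. w \<in> S \<Longrightarrow> f w \<in> \<real>"
    and ab: "a \<in> S" "b \<in> S"
  shows "f a = f b"
proof (cases "f constant_on S")
  case True
  then show ?thesis using ab by (auto simp: constant_on_def)
next
  case False
  then have "open (f ` S)" using open_mapping_thm[OF f S S(1)] by blast
  then obtain e where e: "e > 0" "ball (f a) e \<subseteq> f ` S"
    using ab by (meson imageI openE)
  have "f a + of_real (e/2) * \<i> \<in> ball (f a) e"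
    using e(1) by (simp add: dist_norm norm_mult)
  then have "f a + of_real (e/2) * \<i> \<in> f ` S" by (rule subsetD[OF e(2)])
  then have "f a + of_real (e/2) * \<i> \<in> \<real>" using r by (metis imageE)
  moreover have "f a \<in> \<real>" using r ab by blast
  ultimately show ?thesis using e(1) by (simp add: complex_is_Real_iff)
qed

text \<open>Keeping the inverse as a parameter makes the setting symmetric, so that every result
  about \<open>gam\<close> is also available in the opposite direction.\<close>

locale dyn_iso = D1: dyn_system X1 \<eta>1 + D2: dyn_system X2 \<eta>2
  for X1 :: "'a topology" and \<eta>1 and X2 :: "'b topology" and \<eta>2 +
  fixes \<Phi> :: "'a op \<Rightarrow> 'b op" and \<Psi> :: "'b op \<Rightarrow> 'a op"
  assumes Phi_in: "T \<in> D1.A \<Longrightarrow> \<Phi> T \<in> D2.A" and Psi_in: "R \<in> D2.A \<Longrightarrow> \<Psi> R \<in> D1.A"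
    and Psi_Phi: "T \<in> D1.A \<Longrightarrow> \<Psi> (\<Phi> T) = T" and Phi_Psi: "R \<in> D2.A \<Longrightarrow> \<Phi> (\<Psi> R) = R"
    and Phi_add: "S \<in> D1.A \<Longrightarrow> T \<in> D1.A \<Longrightarrow> \<Phi> (S + T) = \<Phi> S + \<Phi> T"
    and Phi_scale: "T \<in> D1.A \<Longrightarrow> \<Phi> (scaleC_op c T) = scaleC_op c (\<Phi> T)"
    and Phi_mult: "S \<in> D1.A \<Longrightarrow> T \<in> D1.A \<Longrightarrow> \<Phi> (S o\<^sub>L T) = \<Phi> S o\<^sub>L \<Phi> T"
begin

lemma inverse: "dyn_iso X2 \<eta>2 X1 \<eta>1 \<Psi> \<Phi>"
proof
  show "\<Psi> (S + T) = \<Psi> S + \<Psi> T" if "S \<in> D2.A" "T \<in> D2.A" for S T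
    using that Phi_add[of "\<Psi> S" "\<Psi> T"] Psi_Phi[of "\<Psi> S + \<Psi> T"] by (simp add: D1.A_add Psi_in Phi_Psi)
  show "\<Psi> (scaleC_op c T) = scaleC_op c (\<Psi> T)" if "T \<in> D2.A" for c T
    using that Phi_scale[of "\<Psi> T" c] Psi_Phi[of "scaleC_op c (\<Psi> T)"]
    by (simp add: D1.A_scale Psi_in Phi_Psi)
  show "\<Psi> (S o\<^sub>L T) = \<Psi> S o\<^sub>L \<Psi> T" if "S \<in> D2.A" "T \<in> D2.A" for S T
    using that Phi_mult[of "\<Psi> S" "\<Psi> T"] Psi_Phi[of "\<Psi> S o\<^sub>L \<Psi> T"]
    by (simp add: D1.A_mult Psi_in Phi_Psi)
qed (fact Phi_in Psi_in Psi_Phi Phi_Psi)+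

section \<open>The induced map on points\<close>

lemma pullback_character:
  assumes \<phi>: "character D2.A \<phi>"
  shows "character D1.A (\<lambda>T. \<phi> (\<Phi> T))"
proof -
  obtain S where "S \<in> D2.A" "\<phi> S \<noteq> 0" using \<phi> unfolding character_def by blast
  then have "\<exists>T\<in>D1.A. \<phi> (\<Phi> T) \<noteq> 0" by (intro bexI[of _ "\<Psi> S"]) (simp_all add: Phi_Psi Psi_in)
  then show ?thesis
    unfolding character_def
    by (simp add: Phi_add Phi_scale Phi_mult Phi_in character_add[OF \<phi>] character_scale[OF \<phi>] character_mult[OF \<phi>])
qed

text \<open>Characters pull back, hence this map runs against \<open>\<Phi>\<close>, from the second
  space to the first. By \<open>over_unique\<close> the chosen point is the only one
  possible.\<close>

definition gam :: "'b \<Rightarrow> 'a" where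
  "gam y = (SOME x. D1.over (\<lambda>T. D2.theta y 0 (\<Phi> T)) x)"

lemma over_gam:
  assumes "y \<in> topspace X2"
  shows "D1.over (\<lambda>T. D2.theta y 0 (\<Phi> T)) (gam y)"
proof -
  have "character D2.A (D2.theta y 0)" using assms by (intro D2.theta_character) auto
  then obtain x where "D1.over (\<lambda>T. D2.theta y 0 (\<Phi> T)) x"
    using D1.character_over[OF pullback_character] by blast
  then show ?thesis unfolding gam_def by (rule someI)
qed

lemma gam_in: "y \<in> topspace X2 \<Longrightarrow> gam y \<in> topspace X1"
  using over_gam by (auto simp: D1.over_def)

text \<open>
  Over a fixed point \<open>y\<close> the characters \<open>\<theta> y w\<close>, \<open>\<bar>w\<bar> < 1\<close>, form an analytic disc.
  Pulled back to \<open>A\<^sub>1\<close> and evaluated at a real function, they give a real valued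
  holomorphic function of \<open>w\<close>, hence a constant one: the whole disc lies over a single point.
\<close>

lemma character_over_gam:
  assumes \<phi>: "character D2.A \<phi>" and y: "D2.over \<phi> y"
  shows "D1.over (\<lambda>T. \<phi> (\<Phi> T)) (gam y)"
proof -
  have yX: "y \<in> topspace X2" using y by (simp add: D2.over_def)
  obtain x where x: "D1.over (\<lambda>T. \<phi> (\<Phi> T)) x"
    using D1.character_over[OF pullback_character[OF \<phi>]] by blast
  obtain z where z: "norm z \<le> 1" "\<And>g. g \<in> C0 X2 \<Longrightarrow> \<phi> (D2.uemb g) = z * g y" "z = 0 \<or> \<eta>2 y = y"
    using D2.character_parameter[OF \<phi> y] by blast
  have "\<phi> (\<Phi> (D1.emb f)) = D2.theta y 0 (\<Phi> (D1.emb f))" if f: "f \<in> C0 X1" "\<And>x. f x \<in> \<real>" for f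
  proof -
    let ?a = "\<Phi> (D1.emb f)"
    have a: "?a \<in> D2.A" by (rule Phi_in[OF D1.emb_in[OF f(1)]])
    have const: "D2.theta y w ?a = D2.theta y 0 ?a" if w: "norm w < 1" "w = 0 \<or> \<eta>2 y = y" for w
    proof (cases "w = 0")
      case False
      then have fx: "\<eta>2 y = y" using w by blast
      have "D2.theta y v ?a \<in> \<real>" if v: "v \<in> ball 0 1" for v
      proof -
        have ch: "character D2.A (D2.theta y v)" using v yX fx by (intro D2.theta_character) auto
        obtain x' where "D1.over (\<lambda>T. D2.theta y v (\<Phi> T)) x'"
          using D1.character_over[OF pullback_character[OF ch]] by blast
        then have "D2.theta y v ?a = f x'" using f(1) by (simp add: D1.over_def)
        then show ?thesis using f(2) by simp
      qed
      then show ?thesis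
        using w by (intro real_valued_holomorphic_constant[OF D2.theta_holomorphic[of y ?a]]) auto
    qed simp
    \<comment> \<open>The parameter \<open>z\<close> of \<phi> may lie on the unit circle; a radial
      limit carries the constant value from the open disc to \<phi> itself.\<close>
    have lim: "((\<lambda>r. D2.theta y (of_real r * z) ?a) \<longlongrightarrow> \<phi> ?a) (at_left 1)"
      by (rule D2.theta_tendsto_character[OF \<phi> y z a])
    have "\<forall>\<^sub>F r in at_left (1::real). 0 < r \<and> r < 1"
      using eventually_at_left[of 0 "1::real" "\<lambda>r. 0 < r \<and> r < 1"] by (auto intro!: exI[of _ 0])
    then have "\<forall>\<^sub>F r in at_left (1::real). D2.theta y (of_real r * z) ?a = D2.theta y 0 ?a"
    proof eventually_elim
      case (elim r)
      have "r * norm z \<le> r * 1" using elim z(1) by (intro mult_left_mono) auto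
      then have "norm (of_real r * z) < 1" using elim by (simp only: norm_mult norm_of_real) linarith
      then show ?case using z(3) by (intro const) auto
    qed
    then have "((\<lambda>r. D2.theta y (of_real r * z) ?a) \<longlongrightarrow> D2.theta y 0 ?a) (at_left (1::real))"
      by (rule tendsto_eventually)
    then show ?thesis by (rule tendsto_unique[OF trivial_limit_at_left_real lim])
  qed
  then have "x = gam y" by (rule D1.over_unique[OF x over_gam[OF yX]])
  then show ?thesis using x by simp
qed

lemma theta_pullback_inj:
  assumes "y \<in> topspace X2" "norm z < 1" "norm w < 1"
    and eq: "\<And>T. T \<in> D1.A \<Longrightarrow> D2.theta y z (\<Phi> T) = D2.theta y w (\<Phi> T)"
  shows "z = w"
proof -
  obtain e where e: "e \<in> C0 X2" "e y = 1" using D2.C0_peak[OF assms(1)] by metis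
  have "D2.theta y z (D2.uemb e) = D2.theta y w (D2.uemb e)"
    using eq[OF Psi_in[OF D2.uemb_in[OF e(1)]]] by (simp add: Phi_Psi[OF D2.uemb_in[OF e(1)]])
  then show ?thesis using e assms(1) by (simp add: D2.theta_uemb)
qed

text \<open>Over a nonfixed point there is only one character, whereas the disc over a fixed
  \<open>y\<close> pulls back to pairwise different characters, all lying over
  \<open>gam y\<close>.\<close>

lemma gam_fixed:
  assumes y: "y \<in> topspace X2" "\<eta>2 y = y"
  shows "\<eta>1 (gam y) = gam y"
proof (rule ccontr)
  assume nf: "\<eta>1 (gam y) \<noteq> gam y"
  have eq: "D2.theta y w (\<Phi> T) = D1.theta (gam y) 0 T" if "norm w < 1" "T \<in> D1.A" for w T
  proof -
    have ch: "character D2.A (D2.theta y w)" using that y by (intro D2.theta_character) auto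
    show ?thesis
      by (rule D1.character_nonfixed[OF pullback_character[OF ch]
          character_over_gam[OF ch D2.theta_over[OF y(1)]] nf that(2)])
  qed
  have "(0::complex) = 1/2"
    by (rule theta_pullback_inj[OF y(1)]) (simp_all add: eq)
  then show False by simp
qed

lemma gam_C0:
  assumes f: "f \<in> C0 X1"
  shows "(\<lambda>y. f (gam y)) \<in> C0 X2"
proof (rule C0_cong)
  show "coef 0 (\<Phi> (D1.emb f)) \<in> C0 X2" by (rule D2.coef_C0[OF Phi_in[OF D1.emb_in[OF f]]])
  fix y assume "y \<in> topspace X2"
  from over_gam[OF this] f show "coef 0 (\<Phi> (D1.emb f)) y = f (gam y)"
    by (simp add: D1.over_def D2.theta_zero)
qed

text \<open>Around each point of an open \<open>U\<close>, some function in \<open>C0 X1\<close> is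
  nonzero only inside \<open>U\<close>; \<open>gam_C0\<close> shows that the preimage of its
  nonvanishing set is open.\<close>

lemma gam_continuous: "continuous_map X2 X1 gam"
proof -
  have "openin X2 {y \<in> topspace X2. gam y \<in> U}" if U: "openin X1 U" for U
  proof (subst openin_subopen, intro ballI)
    fix y assume "y \<in> {y \<in> topspace X2. gam y \<in> U}"
    then have y: "y \<in> topspace X2" "gam y \<in> U" by auto
    show "\<exists>T. openin X2 T \<and> y \<in> T \<and> T \<subseteq> {y \<in> topspace X2. gam y \<in> U}"
    proof (rule C0_separation[OF D1.lc D1.haus U y(2)])
      fix f assume f: "f \<in> C0 X1" "f (gam y) = 1" "\<And>x. x \<in> topspace X1 - U \<Longrightarrow> f x = 0"
      have "openin X2 {y \<in> topspace X2. f (gam y) \<in> - {0}}"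
        by (rule openin_continuous_map_preimage[OF C0_cont[OF gam_C0[OF f(1)]]]) (simp add: open_Compl)
      moreover have "{y \<in> topspace X2. f (gam y) \<in> - {0}} \<subseteq> {y \<in> topspace X2. gam y \<in> U}"
        using f(3) gam_in by fastforce
      moreover have "y \<in> {y \<in> topspace X2. f (gam y) \<in> - {0}}" using y f(2) by simp
      ultimately show ?thesis by blast
    qed
  qed
  then show ?thesis using gam_in by (simp add: continuous_map_def)
qed

sublocale inv: dyn_iso X2 \<eta>2 X1 \<eta>1 \<Psi> \<Phi>
  by (rule inverse)

text \<open>Pulling \<open>theta y 0\<close> back along \<open>\<Phi>\<close> and then along
  \<open>\<Psi>\<close> returns it. The intermediate character need not be the centre of its disc,
  which is why \<open>character_over_gam\<close> treats arbitrary characters.\<close>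

lemma gam_inverse:
  assumes y: "y \<in> topspace X2"
  shows "inv.gam (gam y) = y"
proof (rule D2.over_unique)
  have ch: "character D2.A (D2.theta y 0)" using y by (intro D2.theta_character) auto
  show "D2.over (\<lambda>S. D2.theta y 0 (\<Phi> (\<Psi> S))) (inv.gam (gam y))"
    by (rule inv.character_over_gam[OF pullback_character[OF ch] over_gam[OF y]])
  show "D2.over (D2.theta y 0) y" by (rule D2.theta_over[OF y])
qed (simp add: Phi_Psi D2.emb_in)

lemma gam_fixed_iff:
  assumes y: "y \<in> topspace X2"
  shows "\<eta>1 (gam y) = gam y \<longleftrightarrow> \<eta>2 y = y"
  using gam_fixed[OF y] inv.gam_fixed[OF gam_in[OF y]] by (auto simp: gam_inverse[OF y])

text \<open>
  The pullback of \<open>\<theta> y 0\<close> cannot sit on the boundary of the disc over \<open>gam y\<close>: by the maximum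
  principle the whole disc over \<open>y\<close> would be mapped to that single boundary point.
\<close>

lemma theta_pullback_interior:
  assumes y: "y \<in> topspace X2"
  obtains z where "norm z < 1" "z = 0 \<or> \<eta>1 (gam y) = gam y"
    "\<And>T. T \<in> D1.A \<Longrightarrow> D2.theta y 0 (\<Phi> T) = D1.theta (gam y) z T"
proof -
  let ?\<phi> = "\<lambda>w T. D2.theta y w (\<Phi> T)"
  have ch0: "character D2.A (D2.theta y 0)" using y by (intro D2.theta_character) auto
  note ch = pullback_character[OF ch0]
  obtain z where z: "norm z \<le> 1" "\<And>g. g \<in> C0 X1 \<Longrightarrow> ?\<phi> 0 (D1.uemb g) = z * g (gam y)"
      "z = 0 \<or> \<eta>1 (gam y) = gam y"
    using D1.character_parameter[OF ch over_gam[OF y]] by blast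
  have "norm z \<noteq> 1"
  proof
    assume nz: "norm z = 1"
    then have "z \<noteq> 0" by auto
    then have fx: "\<eta>2 y = y" using z(3) gam_fixed_iff[OF y] by blast
    obtain e where e: "e \<in> C0 X1" "e (gam y) = 1" using D1.C0_peak[OF gam_in[OF y]] by metis
    \<comment> \<open>This is the disc parameter of the pullback of \<open>theta y w\<close>. It is
      holomorphic in \<open>w\<close>, bounded by one, and of modulus one at the centre, hence
      constant.\<close>
    define \<zeta> where "\<zeta> = (\<lambda>w. ?\<phi> w (D1.uemb e))"
    have hol: "\<zeta> holomorphic_on ball 0 1" unfolding \<zeta>_def by (rule D2.theta_holomorphic)
    have chw: "character D2.A (D2.theta y w)" if "norm w < 1" for w
      using that y fx by (intro D2.theta_character) auto
    have ov: "D1.over (?\<phi> w) (gam y)" if "norm w < 1" for w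
      by (rule character_over_gam[OF chw[OF that] D2.theta_over[OF y]])
    have par: "norm (\<zeta> w) \<le> 1 \<and> (\<forall>g\<in>C0 X1. ?\<phi> w (D1.uemb g) = \<zeta> w * g (gam y))"
      if w: "norm w < 1" for w
    proof -
      obtain v where v: "norm v \<le> 1" "\<And>g. g \<in> C0 X1 \<Longrightarrow> ?\<phi> w (D1.uemb g) = v * g (gam y)"
        using D1.character_parameter[OF pullback_character[OF chw[OF w]] ov[OF w]] by blast
      have "\<zeta> w = v" using v(2)[OF e(1)] e(2) by (simp add: \<zeta>_def)
      then show ?thesis using v by blast
    qed
    have "\<zeta> 0 = z" using z(2)[OF e(1)] e(2) by (simp add: \<zeta>_def)
    then have "\<zeta> constant_on ball 0 1"
      using par nz
      by (intro maximum_modulus_principle[OF hol open_ball connected_ball open_ball subset_refl, of 0]) auto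
    then have c: "\<zeta> (1/2) = \<zeta> 0" by (auto simp: constant_on_def)
    have eq: "?\<phi> 0 T = ?\<phi> (1/2) T" if T: "T \<in> D1.A" for T
    proof (rule D1.character_eqI[OF ch pullback_character[OF chw] _ _ T])
      show "?\<phi> 0 (D1.emb f) = ?\<phi> (1/2) (D1.emb f)" if "f \<in> C0 X1" for f
        using ov[of 0] ov[of "1/2"] that by (simp add: D1.over_def)
      show "?\<phi> 0 (D1.uemb f) = ?\<phi> (1/2) (D1.uemb f)" if "f \<in> C0 X1" for f
        using par[of 0] par[of "1/2"] c that by simp
    qed simp
    have "(0::complex) = 1/2"
      by (rule theta_pullback_inj[OF y]) (simp_all add: eq)
    then show False by simp
  qed
  then have "norm z < 1" using z(1) by simp
  then show ?thesis
    using z(2,3) D1.character_eq_theta[OF ch over_gam[OF y]] by (intro that[of z]) auto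
qed

end

section \<open>Recovery of the dynamics\<close>

context dyn_iso
begin

text \<open>For nonfixed \<open>y\<close>, the transported derivation \<open>D\<close> would be
  inner if \<open>\<eta>1 x\<close> differed from \<open>x'\<close>. It takes the value 1 at an
  element killed by both characters, so it is not inner.\<close>

lemma gam_commute:
  assumes y: "y \<in> topspace X2"
  shows "gam (\<eta>2 y) = \<eta>1 (gam y)"
proof (cases "\<eta>2 y = y")
  case True
  then show ?thesis using gam_fixed[OF y] by simp
next
  case False
  define x where "x = gam y"
  define y' where "y' = \<eta>2 y"
  define x' where "x' = gam y'"
  have in_X: "x \<in> topspace X1" "y' \<in> topspace X2" "x' \<in> topspace X1"
    using y by (auto simp: x_def x'_def y'_def gam_in D2.eta_in)
  have nfx: "\<eta>1 x \<noteq> x" using False gam_fixed_iff[OF y] by (simp add: x_def)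
  have "inv.gam x = y" "inv.gam x' = y'"
    using y in_X by (simp_all add: x_def x'_def gam_inverse)
  then have neq: "x \<noteq> x'" using False by (auto simp: y'_def)
  have ch: "character D2.A (D2.theta y 0)" using y by (intro D2.theta_character) auto
  have \<phi>: "D2.theta y 0 (\<Phi> T) = D1.theta x 0 T" if "T \<in> D1.A" for T
    using D1.character_nonfixed[OF pullback_character[OF ch] over_gam[OF y]] nfx that
    by (simp add: x_def)
  \<comment> \<open>The centre of the disc over \<open>x'\<close> may correspond to an off-centre
    parameter over \<open>y'\<close>, hence the derivation with general \<open>z\<close>.\<close>
  obtain z where z: "norm z < 1" "z = 0 \<or> \<eta>2 y' = y'"
      "\<And>S. S \<in> D2.A \<Longrightarrow> D1.theta x' 0 (\<Psi> S) = D2.theta y' z S"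
    using inv.theta_pullback_interior[OF in_X(3)] unfolding \<open>inv.gam x' = y'\<close> by blast
  have \<psi>: "D2.theta (\<eta>2 y) z (\<Phi> T) = D1.theta x' 0 T" if "T \<in> D1.A" for T
    using z(3)[OF Phi_in[OF that]] by (simp add: Psi_Phi[OF that] y'_def)
  define D where "D = (\<lambda>T. D2.pder y z (\<Phi> T))"
  have "\<eta>1 x = x'"
  proof (rule ccontr)
    assume "\<eta>1 x \<noteq> x'"
    then have "\<exists>c. \<forall>T\<in>D1.A. D T = c * (D1.theta x 0 T - D1.theta x' 0 T)"
    proof (rule D1.point_derivation_inner[OF in_X(1,3) neq])
      show "D (S + T) = D S + D T" if "S \<in> D1.A" "T \<in> D1.A" for S T
        using that z(1) by (simp add: D_def Phi_add D2.pder_add)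
      show "D (S o\<^sub>L T) = D S * D1.theta x 0 T + D1.theta x' 0 S * D T"
        if "S \<in> D1.A" "T \<in> D1.A" for S T
        using D2.pder_mult[OF z(1) y _ Phi_in[OF that(1)], of "\<Phi> T"] z(2) that
        by (simp add: D_def Phi_mult \<phi> \<psi> y'_def)
    qed
    then obtain c where c: "\<And>T. T \<in> D1.A \<Longrightarrow> D T = c * (D1.theta x 0 T - D1.theta x' 0 T)" by blast
    \<comment> \<open>Vanishing at \<open>y'\<close> makes \<open>theta y' z\<close> zero on
      \<open>uemb g\<close> even for nonzero \<open>z\<close>; the value at \<open>y\<close> makes
      the derivation 1.\<close>
    obtain g where g: "g \<in> C0 X2" "g y = 1" "g y' = 0"
      using D2.C0_separate_points[OF y in_X(2)] False unfolding y'_def by metis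
    have T: "\<Psi> (D2.uemb g) \<in> D1.A" "\<Phi> (\<Psi> (D2.uemb g)) = D2.uemb g"
      using g(1) by (simp_all add: Psi_in Phi_Psi D2.uemb_in)
    have "D (\<Psi> (D2.uemb g)) = 1"
      using g y by (simp add: D_def T D2.pder_uemb)
    moreover have "D1.theta x 0 (\<Psi> (D2.uemb g)) = 0"
      using \<phi>[OF T(1)] g y by (simp add: T D2.theta_uemb)
    moreover have "D1.theta x' 0 (\<Psi> (D2.uemb g)) = 0"
      using \<psi>[OF T(1)] g in_X by (simp add: T D2.theta_uemb y'_def)
    ultimately show False using c[OF T(1)] by simp
  qed
  then show ?thesis by (simp add: x_def x'_def y'_def)
qed

end

context dyn_iso
begin

lemma conjugate: "conjugate_systems X1 \<eta>1 X2 \<eta>2"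
  unfolding conjugate_systems_def
proof (intro exI conjI ballI)
  \<comment> \<open>Since \<open>gam\<close> runs backwards, the conjugacy from the first system to
    the second is \<open>inv.gam\<close>.\<close>
  have "homeomorphic_maps X1 X2 inv.gam gam"
    unfolding homeomorphic_maps_def
    using gam_continuous inv.gam_continuous gam_inverse inv.gam_inverse by blast
  then show "homeomorphic_map X1 X2 inv.gam" using homeomorphic_map_maps by blast
  show "inv.gam (\<eta>1 x) = \<eta>2 (inv.gam x)" if "x \<in> topspace X1" for x
    by (rule inv.gam_commute[OF that])
qed

end

lemma algebra_isomorphic_imp_conjugate:
  assumes "dyn_system X1 \<eta>1" "dyn_system X2 \<eta>2"
    and "algebra_isomorphic (semicrossed_product X1 \<eta>1) (semicrossed_product X2 \<eta>2)"
  shows "conjugate_systems X1 \<eta>1 X2 \<eta>2"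
proof -
  let ?A = "semicrossed_product X1 \<eta>1"
  obtain \<Phi> where \<Phi>: "bij_betw \<Phi> ?A (semicrossed_product X2 \<eta>2)"
      "\<forall>S\<in>?A. \<forall>T\<in>?A. \<Phi> (S + T) = \<Phi> S + \<Phi> T"
      "\<forall>c. \<forall>T\<in>?A. \<Phi> (scaleC_op c T) = scaleC_op c (\<Phi> T)"
      "\<forall>S\<in>?A. \<forall>T\<in>?A. \<Phi> (S o\<^sub>L T) = \<Phi> S o\<^sub>L \<Phi> T"
    using assms(3) unfolding algebra_isomorphic_def by blast
  interpret dyn_iso X1 \<eta>1 X2 \<eta>2 \<Phi> "inv_into ?A \<Phi>"
    using assms(1,2) \<Phi> bij_betw_apply[OF \<Phi>(1)] bij_betw_apply[OF bij_betw_inv_into[OF \<Phi>(1)]]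
      bij_betw_inv_into_left[OF \<Phi>(1)] bij_betw_inv_into_right[OF \<Phi>(1)]
    by (intro dyn_iso.intro dyn_iso_axioms.intro) simp_all
  show ?thesis by (rule conjugate)
qed

section \<open>Conjugacies\<close>

text \<open>Composition with \<delta>, extended by zero off \<open>Y\<close>. Injectivity of
  \<delta> on \<open>Y\<close> prevents repeated coordinates and makes this a contraction.\<close>

definition pull_op :: "'b set \<Rightarrow> ('b \<Rightarrow> 'a) \<Rightarrow> ('a, 'h::real_normed_vector) l2 \<Rightarrow>\<^sub>L ('b, 'h) l2" where
  "pull_op Y \<delta> = Blinfun (\<lambda>\<xi>. Abs_l2 (\<lambda>y. if y \<in> Y then l2_nth \<xi> (\<delta> y) else 0))"

lemma l2_nth_pull_op:
  fixes \<delta> :: "'b \<Rightarrow> 'a"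
  assumes inj: "inj_on \<delta> Y"
  shows "l2_nth (pull_op Y \<delta> \<xi>) y = (if y \<in> Y then l2_nth \<xi> (\<delta> y) else 0)"
proof -
  let ?g = "\<lambda>(\<xi> :: ('a, 'c) l2) y. if y \<in> Y then l2_nth \<xi> (\<delta> y) else 0"
  have le: "L2_set (\<lambda>y. norm (?g \<xi> y)) F \<le> norm \<xi>" if "finite F" for F \<xi>
  proof -
    have "(\<Sum>y\<in>F. (norm (?g \<xi> y))\<^sup>2) = (\<Sum>y\<in>F \<inter> Y. (norm (l2_nth \<xi> (\<delta> y)))\<^sup>2)"
      using that by (intro sum.mono_neutral_cong_right) auto
    also have "\<dots> = (\<Sum>x\<in>\<delta> ` (F \<inter> Y). (norm (l2_nth \<xi> x))\<^sup>2)"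
      by (subst sum.reindex) (auto intro: inj_on_subset[OF inj])
    finally have "L2_set (\<lambda>y. norm (?g \<xi> y)) F = L2_set (\<lambda>x. norm (l2_nth \<xi> x)) (\<delta> ` (F \<inter> Y))"
      by (simp add: L2_set_def)
    then show ?thesis using L2_set_le_norm_l2[of "\<delta> ` (F \<inter> Y)" \<xi>] that by simp
  qed
  have nth: "l2_nth (Abs_l2 (?g \<xi>)) = ?g \<xi>" for \<xi>
    using square_summable_bound(1)[OF le] by (simp add: Abs_l2_inverse)
  have "bounded_linear (\<lambda>\<xi>. Abs_l2 (?g \<xi>))"
  proof (rule bounded_linear_intro[where K = 1])
    show "Abs_l2 (?g (\<xi> + \<zeta>)) = Abs_l2 (?g \<xi>) + Abs_l2 (?g \<zeta>)" for \<xi> \<zeta>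
      by (rule l2_eqI) (unfold nth, simp add: plus_l2.rep_eq nth)
    show "Abs_l2 (?g (r *\<^sub>R \<xi>)) = r *\<^sub>R Abs_l2 (?g \<xi>)" for r \<xi>
      by (rule l2_eqI) (unfold nth, simp add: scaleR_l2.rep_eq nth)
    show "norm (Abs_l2 (?g \<xi>)) \<le> norm \<xi> * 1" for \<xi>
      using square_summable_bound(2)[OF le[of _ \<xi>]] by (simp add: norm_l2.rep_eq[of "Abs_l2 (?g \<xi>)"] nth)
  qed
  then show ?thesis
    unfolding pull_op_def by (simp add: bounded_linear_Blinfun_apply nth)
qed

section \<open>Spatial transport along a conjugacy\<close>

locale dyn_conj = D1: dyn_system X1 \<eta>1 + D2: dyn_system X2 \<eta>2
  for X1 :: "'a topology" and \<eta>1 and X2 :: "'b topology" and \<eta>2 +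
  fixes \<gamma> :: "'a \<Rightarrow> 'b" and \<delta> :: "'b \<Rightarrow> 'a"
  assumes maps: "homeomorphic_maps X1 X2 \<gamma> \<delta>"
    and conj: "x \<in> topspace X1 \<Longrightarrow> \<gamma> (\<eta>1 x) = \<eta>2 (\<gamma> x)"
begin

lemma gamma_in: "x \<in> topspace X1 \<Longrightarrow> \<gamma> x \<in> topspace X2"
  and delta_in: "y \<in> topspace X2 \<Longrightarrow> \<delta> y \<in> topspace X1"
  and delta_gamma: "x \<in> topspace X1 \<Longrightarrow> \<delta> (\<gamma> x) = x"
  and gamma_delta: "y \<in> topspace X2 \<Longrightarrow> \<gamma> (\<delta> y) = y"
  using maps by (auto simp: homeomorphic_maps_def continuous_map_def Pi_iff)

lemma delta_conj: "y \<in> topspace X2 \<Longrightarrow> \<delta> (\<eta>2 y) = \<eta>1 (\<delta> y)"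
  using conj[of "\<delta> y"] delta_gamma[of "\<eta>1 (\<delta> y)"] by (simp add: delta_in gamma_delta D1.eta_in)

lemma delta_iter: "y \<in> topspace X2 \<Longrightarrow> \<delta> ((\<eta>2 ^^ n) y) = (\<eta>1 ^^ n) (\<delta> y)"
  by (induction n) (simp_all add: delta_conj D2.iter_in)

lemma C0_delta:
  assumes "f \<in> C0 X1"
  shows "(\<lambda>y. f (\<delta> y)) \<in> C0 X2"
proof -
  have "homeomorphic_map X2 X1 \<delta>" using maps homeomorphic_maps_map by blast
  then show ?thesis
    by (intro C0_comp[OF assms] homeomorphic_imp_continuous_map homeomorphic_imp_proper_map)
qed

definition transport :: "'a op \<Rightarrow> 'b op" where
  "transport T = pull_op (topspace X2) \<delta> o\<^sub>L T o\<^sub>L pull_op (topspace X1) \<gamma>"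

lemma entry_pull_gamma:
  "entry (pull_op (topspace X1) \<gamma> \<zeta>) x n = (if x \<in> topspace X1 then entry \<zeta> (\<gamma> x) n else 0)"
proof -
  have "inj_on \<gamma> (topspace X1)" using delta_gamma by (rule inj_on_inverseI)
  then show ?thesis by (simp add: l2_nth_pull_op zero_l2.rep_eq)
qed

lemma entry_pull_delta:
  "entry (pull_op (topspace X2) \<delta> \<xi>) y n = (if y \<in> topspace X2 then entry \<xi> (\<delta> y) n else 0)"
proof -
  have "inj_on \<delta> (topspace X2)" using gamma_delta by (rule inj_on_inverseI)
  then show ?thesis by (simp add: l2_nth_pull_op zero_l2.rep_eq)
qed

lemma entry_transport:
  "entry (transport T \<zeta>) y n
    = (if y \<in> topspace X2 then entry (T (pull_op (topspace X1) \<gamma> \<zeta>)) (\<delta> y) n else 0)"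
  by (simp add: transport_def entry_pull_delta)

lemma transport_add: "transport (S + T) = transport S + transport T"
  by (rule op_eqI) (simp add: entry_transport blinfun.add_left entry_simps)

lemma transport_scale: "transport (scaleC_op c T) = scaleC_op c (transport T)"
  by (rule op_eqI) (simp add: entry_transport l2_nth_scaleC_op)

text \<open>The two pull operators compose to the projection onto the summands over
  \<open>topspace X1\<close>, and the range of \<open>T\<close> already lies there.\<close>

lemma transport_mult:
  assumes "S \<in> D1.A" "T \<in> D1.A"
  shows "transport (S o\<^sub>L T) = transport S o\<^sub>L transport T"
proof -
  have "pull_op (topspace X1) \<gamma> (pull_op (topspace X2) \<delta> (T \<xi>)) = T \<xi>" for \<xi>
    by (intro l2_eqI)
      (auto simp: entry_pull_gamma entry_pull_delta gamma_in delta_gamma D1.entry_A_outside assms(2))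
  then show ?thesis by (intro blinfun_eqI) (simp add: transport_def)
qed

lemma transport_in: "T \<in> D1.A \<Longrightarrow> transport T \<in> D2.A"
proof (induction rule: D1.A_induct)
  case (emb f)
  have "transport (D1.emb f) = D2.emb (\<lambda>y. f (\<delta> y))"
    using emb by (intro op_eqI) (auto simp: entry_transport D1.entry_emb D2.entry_emb C0_delta
      entry_pull_gamma delta_in gamma_delta delta_iter)
  then show ?case using emb by (simp add: D2.emb_in C0_delta)
next
  case (uemb f)
  have "transport (D1.uemb f) = D2.uemb (\<lambda>y. f (\<delta> y))"
    using uemb by (intro op_eqI) (auto simp: entry_transport D1.entry_uemb D2.entry_uemb C0_delta
      entry_pull_gamma delta_in gamma_delta delta_iter split: nat.split)
  then show ?case using uemb by (simp add: D2.uemb_in C0_delta)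
next
  case zero
  have "transport 0 = 0" by (rule op_eqI) (simp add: entry_transport entry_simps)
  then show ?case by (simp add: D2.A_zero)
next
  case (lim S T)
  have "(\<lambda>n. transport (S n)) \<longlonglongrightarrow> transport T"
    unfolding transport_def
    by (intro bounded_bilinear.tendsto[OF bounded_bilinear_blinfun_compose] tendsto_const lim)
  then show ?case by (rule D2.A_limit[rotated]) (rule lim.IH)
qed (simp_all add: transport_add transport_scale transport_mult D2.A_add D2.A_scale D2.A_mult)

lemma inverse: "dyn_conj X2 \<eta>2 X1 \<eta>1 \<delta> \<gamma>"
proof
  show "homeomorphic_maps X2 X1 \<delta> \<gamma>" using maps by (subst homeomorphic_maps_sym)
qed (rule delta_conj)

sublocale inv: dyn_conj X2 \<eta>2 X1 \<eta>1 \<delta> \<gamma>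
  by (rule inverse)

text \<open>By \<open>entry_A\<close>, the component of \<open>T \<xi>\<close> at \<open>x\<close>
  depends only on that of \<xi> at \<open>x\<close>, so erasing the components off the space changes
  nothing.\<close>

lemma transport_inverse:
  assumes "T \<in> D1.A"
  shows "inv.transport (transport T) = T"
proof (rule op_eqI)
  fix \<xi> x n
  show "entry (inv.transport (transport T) \<xi>) x n = entry (T \<xi>) x n"
    using assms by (cases "x \<in> topspace X1")
      (simp_all add: inv.entry_transport entry_transport gamma_in delta_gamma D1.entry_A D1.entry_A_outside
        D1.iter_in entry_pull_gamma entry_pull_delta)
qed

end

context dyn_conj
begin

lemma isomorphic: "algebra_isomorphic D1.A D2.A"
  unfolding algebra_isomorphic_def
proof (intro exI conjI ballI allI)
  show "bij_betw transport D1.A D2.A"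
    by (rule bij_betw_byWitness[where f' = inv.transport])
       (auto simp: transport_inverse inv.transport_inverse transport_in inv.transport_in)
qed (simp_all add: transport_add transport_scale transport_mult)

end

theorem corollary4p7:
  fixes X1 :: "'a topology" and X2 :: "'b topology"
    and \<eta>1 :: "'a \<Rightarrow> 'a" and \<eta>2 :: "'b \<Rightarrow> 'b"
  assumes "locally_compact_space X1" and "Hausdorff_space X1"
    and "locally_compact_space X2" and "Hausdorff_space X2"
    and "continuous_map X1 X1 \<eta>1" and "proper_map X1 X1 \<eta>1"
    and "continuous_map X2 X2 \<eta>2" and "proper_map X2 X2 \<eta>2"
  shows "conjugate_systems X1 \<eta>1 X2 \<eta>2 \<longleftrightarrow>
    algebra_isomorphic (semicrossed_product X1 \<eta>1) (semicrossed_product X2 \<eta>2)"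
proof
  have D: "dyn_system X1 \<eta>1" "dyn_system X2 \<eta>2"
    using assms by (auto intro: dyn_system.intro)
  show "conjugate_systems X1 \<eta>1 X2 \<eta>2"
    if "algebra_isomorphic (semicrossed_product X1 \<eta>1) (semicrossed_product X2 \<eta>2)"
    by (rule algebra_isomorphic_imp_conjugate[OF D that])
  assume "conjugate_systems X1 \<eta>1 X2 \<eta>2"
  then obtain \<gamma> where \<gamma>: "homeomorphic_map X1 X2 \<gamma>" "\<And>x. x \<in> topspace X1 \<Longrightarrow> \<gamma> (\<eta>1 x) = \<eta>2 (\<gamma> x)"
    unfolding conjugate_systems_def by blast
  obtain \<delta> where \<delta>: "homeomorphic_maps X1 X2 \<gamma> \<delta>" using \<gamma>(1) homeomorphic_map_maps by blast
  interpret dyn_conj X1 \<eta>1 X2 \<eta>2 \<gamma> \<delta>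
    using D \<gamma>(2) \<delta> by (intro dyn_conj.intro dyn_conj_axioms.intro)
  show "algebra_isomorphic (semicrossed_product X1 \<eta>1) (semicrossed_product X2 \<eta>2)"
    by (rule isomorphic)
qed

end
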